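(* Let $\mathbb{F}_q$ be a finite field with $q$ elements. For $n\ge 1$, the number $\mathcal{N}(n,\mathbb{F}_q)$ of isomorphism classes of $n$-dimensional idempotent evolution algebras over $\mathbb{F}_q$ is given by $$\mathcal{N}(n,\mathbb{F}_q)=|X/G|=\frac{\sum_{\mu\in\mathcal{P}(n)}B(\mu)}{(q-1)^n},$$ where $\mathcal{P}(n)$ is the set of all partitions of $n$, $|X/G|$ is the number of $G$-orbits in $X=GL_n(\mathbb{F}_q)$, and $$B(\mu)=\frac{\sum_{t\in T_n}b(\mu,t)}{d(\mu)},\qquad d(\mu)=\prod_{k=1}^n m_k(\mu)!\,k^{m_k(\mu)},\qquad b(\mu,t)=|X^{\mu t}|.$$
   Context: An $n$-dimensional evolution algebra over a field $\mathbb{F}$ is a (not necessarily associative) $\mathbb{F}$-algebra $\mathcal{E}$ having a vector space basis $e_1,\dots,e_n$ (a natural basis) such that $e_ie_j=0$ for $i\neq j$; its structure matrix is the $n\times n$ matrix $A$ with $(e_1^2,\dots,e_n^2)=(e_1,\dots,e_n)A$. It is called idempotent if $\mathcal{E}^2=\mathcal{E}$ (equivalently, $A$ is nonsingular). Isomorphism means isomorphism of $\mathbb{F}$-algebras. A permutation $\sigma\in S_n$ is identified with the permutation matrix, also written $\sigma$, determined by $(e_{\sigma(1)},\dots,e_{\sigma(n)})=(e_1,\dots,e_n)\sigma$. $T_n\subset GL_n(\mathbb{F}_q)$ is the subgroup of nonsingular diagonal matrices and $G=S_n\ltimes T_n=\{\sigma t:\sigma\in S_n,\ t\in T_n\}\subset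 GL_n(\mathbb{F}_q)$. $G$ acts on $X=GL_n(\mathbb{F}_q)$ by $\sigma t\colon A\mapsto t^{-1}\sigma^{-1}A\sigma t^2$, and $X^{g}$ denotes the set of fixed points of $g\in G$ in $X$. A partition of $n$ is written $\mu=\{0<\mu_1\le\mu_2\le\cdots\le\mu_r\}$ with $\sum\mu_i=n$. The same symbol $\mu$ denotes the permutation in $S_n$ obtained by splitting $(1,2,\dots,n)$ into consecutive disjoint cycles of lengths $\mu_1,\dots,\mu_r$ (e.g. $n=7$, $\mu=\{1,1,2,3\}$ gives $\mu=(1)(2)(34)(567)$). $m_k(\mu)$ is the number of cycles of length $k$ in $\mu$, i.e. the number of $i$ with $\mu_i=k$. *)

theory Defs
  imports
    "HOL-Library.Cardinality"
    "HOL-Algebra.Group_Action"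
    "HOL-Combinatorics.Cycles"
    "Jordan_Normal_Form.VS_Connect"
begin

section \<open>Evolution algebras and their isomorphism classes\<close>

text \<open>An algebra over a field is a vector space with a bilinear product, neither associative nor
  unital in general. It is carried by the \<open>module\<close> record, whose \<open>mult\<close> field holds the product;
  the record's \<open>one\<close> field plays no role and is left unconstrained. The scalars are the elements
  of the type \<open>'a\<close>.\<close>

locale nonassoc_algebra = vectorspace class_ring E
  for E :: "('a::field, 'v) module" +
  assumes prod_closed:
      "x \<in> carrier E \<Longrightarrow> y \<in> carrier E \<Longrightarrow> x \<otimes>\<^bsub>E\<^esub> y \<in> carrier E"
    and prod_l_distr:
      "x \<in> carrier E \<Longrightarrow> y \<in> carrier E \<Longrightarrow> z \<in> carrier E \<Longrightarrow>
        (x \<oplus>\<^bsub>E\<^esub> y) \<otimes>\<^bsub>E\<^esub> z = x \<otimes>\<^bsub>E\<^esub> z \<oplus>\<^bsub>E\<^esub> y \<otimes>\<^bsub>E\<^esub> z"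
    and prod_r_distr:
      "x \<in> carrier E \<Longrightarrow> y \<in> carrier E \<Longrightarrow> z \<in> carrier E \<Longrightarrow>
        x \<otimes>\<^bsub>E\<^esub> (y \<oplus>\<^bsub>E\<^esub> z) = x \<otimes>\<^bsub>E\<^esub> y \<oplus>\<^bsub>E\<^esub> x \<otimes>\<^bsub>E\<^esub> z"
    and prod_smult_l:
      "x \<in> carrier E \<Longrightarrow> y \<in> carrier E \<Longrightarrow> (c \<odot>\<^bsub>E\<^esub> x) \<otimes>\<^bsub>E\<^esub> y = c \<odot>\<^bsub>E\<^esub> (x \<otimes>\<^bsub>E\<^esub> y)"
    and prod_smult_r:
      "x \<in> carrier E \<Longrightarrow> y \<in> carrier E \<Longrightarrow> x \<otimes>\<^bsub>E\<^esub> (c \<odot>\<^bsub>E\<^esub> y) = c \<odot>\<^bsub>E\<^esub> (x \<otimes>\<^bsub>E\<^esub> y)"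

definition natural_basis :: "nat \<Rightarrow> ('a::field, 'v) module \<Rightarrow> (nat \<Rightarrow> 'v) \<Rightarrow> bool" where
  "natural_basis n E e \<longleftrightarrow>
     inj_on e {0..<n} \<and> vectorspace.basis class_ring E (e ` {0..<n}) \<and>
     (\<forall>i<n. \<forall>j<n. i \<noteq> j \<longrightarrow> e i \<otimes>\<^bsub>E\<^esub> e j = \<zero>\<^bsub>E\<^esub>)"

definition evolution_algebra :: "nat \<Rightarrow> ('a::field, 'v) module \<Rightarrow> bool" where
  "evolution_algebra n E \<longleftrightarrow> nonassoc_algebra E \<and> (\<exists>e. natural_basis n E e)"

text \<open>The square of an algebra is the linear span of all products of two elements.\<close>

definition idempotent_algebra :: "('a::field, 'v) module \<Rightarrow> bool" where
  "idempotent_algebra E \<longleftrightarrow>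
     LinearCombinations.module.span class_ring E {x \<otimes>\<^bsub>E\<^esub> y | x y. x \<in> carrier E \<and> y \<in> carrier E} = carrier E"

definition algebra_iso :: "('a::field, 'v) module \<Rightarrow> ('a, 'w) module \<Rightarrow> bool" where
  "algebra_iso E F \<longleftrightarrow>
     (\<exists>f \<in> LinearCombinations.module_hom class_ring E F. bij_betw f (carrier E) (carrier F) \<and>
        (\<forall>x \<in> carrier E. \<forall>y \<in> carrier E. f (x \<otimes>\<^bsub>E\<^esub> y) = f x \<otimes>\<^bsub>F\<^esub> f y))"

definition idempotent_evolution_algebras :: "nat \<Rightarrow> ('a::field, 'v) module set" where
  "idempotent_evolution_algebras n = {E. evolution_algebra n E \<and> idempotent_algebra E}"

text \<open>The algebras considered have their carrier inside the type \<open>'v\<close>. Over a finite field an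
  \<open>n\<close>-dimensional algebra is finite, so every isomorphism class is represented as soon as
  \<open>'v\<close> is infinite.\<close>

definition num_iso_classes :: "'a::field itself \<Rightarrow> 'v itself \<Rightarrow> nat \<Rightarrow> nat" where
  "num_iso_classes _ _ n =
     (let \<E> = idempotent_evolution_algebras n :: ('a, 'v) module set
      in card (\<E> // {(E, F). E \<in> \<E> \<and> F \<in> \<E> \<and> algebra_iso E F}))"


section \<open>The monomial group and its action\<close>

text \<open>Rows and columns are numbered from \<open>0\<close>, so \<open>S\<^sub>n\<close> consists of the permutations of
  \<open>{0..<n}\<close>.\<close>

definition GL :: "nat \<Rightarrow> 'a::field mat monoid" where
  "GL n = units_of (ring_mat TYPE('a) n ())"

definition diag_subgroup :: "nat \<Rightarrow> 'a::field mat set" where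
  "diag_subgroup n = {t \<in> carrier (GL n). diagonal_mat t}"

text \<open>Column \<open>j\<close> is the standard basis vector with index \<open>\<sigma> j\<close>, that is,
  \<open>(e\<^sub>\<sigma>\<^sub>(\<^sub>1\<^sub>), \<dots>, e\<^sub>\<sigma>\<^sub>(\<^sub>n\<^sub>)) = (e\<^sub>1, \<dots>, e\<^sub>n) \<sigma>\<close>.\<close>

definition perm_mat :: "nat \<Rightarrow> (nat \<Rightarrow> nat) \<Rightarrow> 'a::field mat" where
  "perm_mat n \<sigma> = mat n n (\<lambda>(i, j). if i = \<sigma> j then 1 else 0)"

definition monomial_group :: "nat \<Rightarrow> 'a::field mat monoid" where
  "monomial_group n =
     (GL n)\<lparr>carrier := {perm_mat n \<sigma> * t | \<sigma> t. \<sigma> permutes {0..<n} \<and> t \<in> diag_subgroup n}\<rparr>"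

text \<open>The factors of \<open>g = \<sigma> t\<close> are determined by \<open>g\<close>; see \<open>monomial_act_eq\<close> below.
  This is a right action, \<open>(g h) A = h (g A)\<close>, hence not an instance of the locale
  \<open>group_action\<close>, but the orbits and the fixed points are those of \<open>orbits\<close> and
  \<open>invariants\<close>.\<close>

definition monomial_act :: "nat \<Rightarrow> 'a::field mat \<Rightarrow> 'a mat \<Rightarrow> 'a mat" where
  "monomial_act n g A = (THE B. \<exists>\<sigma> t. \<sigma> permutes {0..<n} \<and> t \<in> diag_subgroup n \<and>
     g = perm_mat n \<sigma> * t \<and>
     B = inv\<^bsub>GL n\<^esub> t * inv\<^bsub>GL n\<^esub> (perm_mat n \<sigma>) * A * perm_mat n \<sigma> * (t * t))"

lemma perm_mat_times_index:
  assumes "\<sigma> permutes {0..<n}" "t \<in> carrier_mat n n" "i < n" "j < n"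
  shows "(perm_mat n \<sigma> * t) $$ (\<sigma> i, j) = t $$ (i, j)"
proof -
  have si: "\<sigma> i < n" using permutes_in_image[OF assms(1), of i] assms(3) by simp
  have "(perm_mat n \<sigma> * t) $$ (\<sigma> i, j) = (\<Sum>k = 0..<n. (if \<sigma> i = \<sigma> k then 1 else 0) * t $$ (k, j))"
    using assms si by (simp add: perm_mat_def scalar_prod_def)
  also have "\<dots> = (\<Sum>k = 0..<n. if k = i then t $$ (k, j) else 0)"
    using permutes_inj[OF assms(1)] by (intro sum.cong) (auto dest: injD)
  also have "\<dots> = t $$ (i, j)" using assms(3) by simp
  finally show ?thesis .
qed

lemma diag_subgroup_nonzero:
  assumes t: "t \<in> diag_subgroup n" and i: "i < n"
  shows "t $$ (i, i) \<noteq> 0"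
proof
  assume z: "t $$ (i, i) = 0"
  from t have u: "t \<in> Units (ring_mat TYPE('a) n ())" and d: "diagonal_mat t"
    by (auto simp: diag_subgroup_def GL_def units_of_def)
  then obtain s where c: "t \<in> carrier_mat n n" "s \<in> carrier_mat n n" and ts: "t * s = 1\<^sub>m n"
    by (auto simp: Units_def ring_mat_simps)
  have "t $$ (i, k) = 0" if "k < n" for k
    using that i z d c unfolding diagonal_mat_def by (cases "k = i") auto
  then have "(t * s) $$ (i, i) = 0"
    using c i by (auto simp: scalar_prod_def intro!: sum.neutral)
  then show False using ts i by simp
qed

lemma monomial_decomp_unique:
  fixes s t :: "'a::field mat"
  assumes \<sigma>: "\<sigma> permutes {0..<n}" and \<tau>: "\<tau> permutes {0..<n}"
    and t: "t \<in> diag_subgroup n" and s: "s \<in> diag_subgroup n"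
    and eq: "perm_mat n \<sigma> * t = perm_mat n \<tau> * s"
  shows "\<sigma> = \<tau> \<and> t = s"
proof -
  have c: "t \<in> carrier_mat n n" "s \<in> carrier_mat n n"
    and d: "diagonal_mat t" "diagonal_mat s"
    using t s by (auto simp: diag_subgroup_def GL_def units_of_def Units_def ring_mat_simps)
  have st: "\<sigma> i = \<tau> i" if i: "i < n" for i
  proof -
    have "\<sigma> i \<in> {0..<n}" using permutes_in_image[OF \<sigma>, of i] i by simp
    then obtain k where k: "k < n" "\<tau> k = \<sigma> i"
      using permutes_image[OF \<tau>] by (metis atLeastLessThan_iff imageE)
    have "s $$ (k, i) = t $$ (i, i)"
      using perm_mat_times_index[OF \<sigma> c(1) i i] perm_mat_times_index[OF \<tau> c(2) k(1) i] eq k(2)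
      by simp
    then have "s $$ (k, i) \<noteq> 0" using diag_subgroup_nonzero[OF t i] by simp
    then have "k = i" using d(2) c(2) k(1) i unfolding diagonal_mat_def by auto
    then show ?thesis using k by simp
  qed
  have "\<sigma> = \<tau>"
  proof
    fix i
    show "\<sigma> i = \<tau> i"
      using st[of i] permutes_not_in[OF \<sigma>, of i] permutes_not_in[OF \<tau>, of i] by (cases "i < n") auto
  qed
  moreover have "t = s"
  proof (rule eq_matI)
    fix i j assume "i < dim_row s" "j < dim_col s"
    then have "i < n" "j < n" using c by auto
    then show "t $$ (i, j) = s $$ (i, j)"
      using perm_mat_times_index[OF \<sigma> c(1)] perm_mat_times_index[OF \<tau> c(2)] eq st[of i] by metis
  qed (use c in auto)
  ultimately show ?thesis by simp
qed

lemma monomial_act_eq: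
  assumes "\<sigma> permutes {0..<n}" "t \<in> diag_subgroup n"
  shows "monomial_act n (perm_mat n \<sigma> * t) A =
    inv\<^bsub>GL n\<^esub> t * inv\<^bsub>GL n\<^esub> (perm_mat n \<sigma>) * A * perm_mat n \<sigma> * (t * t)"
  unfolding monomial_act_def
  by (rule the_equality) (use assms monomial_decomp_unique in blast)+


section \<open>Partitions\<close>

definition partitions :: "nat \<Rightarrow> nat list set" where
  "partitions n = {\<mu>. sorted \<mu> \<and> (\<forall>k \<in> set \<mu>. 0 < k) \<and> sum_list \<mu> = n}"

text \<open>\<open>cycles_from s \<mu>\<close> splits the numbers \<open>s, s + 1, \<dots>\<close> into consecutive cycles
  whose lengths are the entries of \<open>\<mu>\<close>.\<close>

fun cycles_from :: "nat \<Rightarrow> nat list \<Rightarrow> nat \<Rightarrow> nat" where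
  "cycles_from s [] = id"
| "cycles_from s (k # \<mu>) = cycle_of_list [s..<s + k] \<circ> cycles_from (s + k) \<mu>"

definition partition_perm :: "nat list \<Rightarrow> nat \<Rightarrow> nat" where
  "partition_perm \<mu> = cycles_from 0 \<mu>"

definition d_coeff :: "nat \<Rightarrow> nat list \<Rightarrow> nat" where
  "d_coeff n \<mu> = (\<Prod>k = 1..n. fact (count_list \<mu> k) * k ^ count_list \<mu> k)"

definition b_coeff :: "nat \<Rightarrow> nat list \<Rightarrow> 'a::field mat \<Rightarrow> nat" where
  "b_coeff n \<mu> t =
     card (invariants (carrier (GL n)) (monomial_act n) (perm_mat n (partition_perm \<mu>) * t))"

definition B_coeff :: "'a::field itself \<Rightarrow> nat \<Rightarrow> nat list \<Rightarrow> real" where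
  "B_coeff _ n \<mu> =
     (\<Sum>t \<in> (diag_subgroup n :: 'a mat set). real (b_coeff n \<mu> t)) / real (d_coeff n \<mu>)"

end

theory Submission
  imports Defs
begin

text \<open>In an idempotent evolution algebra the squares of a natural basis are again a basis. If
  \<open>P\<close> expresses one natural basis in terms of another, orthogonality of the new basis says that
  the entrywise product of two different columns of \<open>P\<close> is annihilated by the old structure matrix,
  hence is zero. So every row of \<open>P\<close> has at most one nonzero entry, and \<open>P\<close>, being invertible,
  is monomial (\<open>monomial_if_orthogonal_columns\<close>). Comparing squares, the structure matrices \<open>B\<close> of
  the old and \<open>A\<close> of the new basis satisfy \<open>A = P\<inverse> B P\<^sup>(\<^sup>2\<^sup>)\<close> with \<open>P\<^sup>(\<^sup>2\<^sup>)\<close> the matrix of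
  squared entries, and for
  \<open>P = \<sigma> t\<close> this is precisely the action of \<open>\<sigma> t\<close>. Every algebra with a natural basis is isomorphic to
  the one on coordinate space with its structure matrix, so isomorphism classes correspond to orbits.

  The number of orbits is then given by the lemma of Burnside, the group having \<open>n! (q - 1)\<^sup>n\<close>
  elements. Conjugation by the permutation matrix of \<open>\<tau>\<close> carries the coset \<open>\<sigma> T\<^sub>n\<close> to
  \<open>(\<tau> \<sigma> \<tau>\<inverse>) T\<^sub>n\<close> and preserves the number of fixed points, so the sum over \<open>\<sigma> T\<^sub>n\<close> is a class
  function of \<open>\<sigma>\<close> (\<open>sum_invariants_conj\<close>). Its sum over the symmetric group collects into a sum over
  partitions, with \<open>n! / d(\<mu>)\<close> permutations of type \<open>\<mu>\<close> (\<open>sum_class_function\<close>).\<close>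

section \<open>Counting permutations by cycle type\<close>

definition points_of_period :: "('a \<Rightarrow> 'a) \<Rightarrow> 'a set \<Rightarrow> nat \<Rightarrow> 'a set" where
  "points_of_period \<sigma> A k = {b \<in> A. least_power \<sigma> b = k}"

text \<open>A cycle of length \<open>k\<close> contributes \<open>k\<close> points of period \<open>k\<close>, so counting points avoids
  talking about the set of cycles. For \<open>k = 0\<close> both sides vanish, as periods of a
  permutation are positive.\<close>

definition has_cycle_type :: "('a \<Rightarrow> 'a) \<Rightarrow> 'a set \<Rightarrow> nat list \<Rightarrow> bool" where
  "has_cycle_type \<sigma> A \<mu> \<longleftrightarrow> (\<forall>k. card (points_of_period \<sigma> A k) = k * count_list \<mu> k)"

text \<open>The ways to write the elements of \<open>A\<close> in a row as consecutive \<open>\<sigma>\<close>-cycles whose lengths are,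
  in this order, the entries of \<open>\<mu>\<close>: a choice of starting point for the first cycle is followed by
  a listing of what remains. A bijection \<open>\<tau>\<close> that carries the standard permutation
  of type \<open>\<mu>\<close> to \<open>\<sigma>\<close> by conjugation is the same thing as such a row, read as the list of values
  of \<open>\<tau>\<close>.\<close>

fun cycle_listings :: "('a \<Rightarrow> 'a) \<Rightarrow> nat list \<Rightarrow> 'a set \<Rightarrow> 'a list set" where
  "cycle_listings \<sigma> [] A = (if A = {} then {[]} else {})"
| "cycle_listings \<sigma> (k # \<mu>) A =
     (\<Union>b \<in> points_of_period \<sigma> A k.
        (@) (support \<sigma> b) ` cycle_listings \<sigma> \<mu> (A - set (support \<sigma> b)))"

lemma least_power_funpow:
  assumes "permutation \<sigma>"
  shows "least_power \<sigma> ((\<sigma> ^^ i) a) = least_power \<sigma> a"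
proof -
  have inj: "inj (\<sigma> ^^ i)" using assms by (simp add: bij_is_inj inj_fn permutation)
  have "(\<sigma> ^^ m) ((\<sigma> ^^ i) a) = (\<sigma> ^^ i) a \<longleftrightarrow> (\<sigma> ^^ m) a = a" for m
  proof -
    have "(\<sigma> ^^ m) ((\<sigma> ^^ i) a) = (\<sigma> ^^ i) ((\<sigma> ^^ m) a)"
      by (metis add.commute comp_apply funpow_add)
    then show ?thesis using inj by (simp add: inj_eq)
  qed
  then have "least_power \<sigma> ((\<sigma> ^^ i) a) dvd m \<longleftrightarrow> least_power \<sigma> a dvd m" for m
    using least_power_dvd[OF assms] by metis
  then show ?thesis by (meson dvd_antisym dvd_refl)
qed

lemma card_support: "permutation \<sigma> \<Longrightarrow> card (set (support \<sigma> b)) = least_power \<sigma> b"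
  using distinct_card[OF cycle_of_permutation] by fastforce

lemma funpow_image_closed: "\<sigma> ` A = A \<Longrightarrow> b \<in> A \<Longrightarrow> (\<sigma> ^^ i) b \<in> A"
  by (induction i) auto

lemma remove_orbit_closed:
  assumes "permutation \<sigma>" "\<sigma> ` A = A"
  shows "\<sigma> ` (A - set (support \<sigma> b)) = A - set (support \<sigma> b)"
proof -
  have inj: "inj \<sigma>" using assms(1) by (simp add: bij_is_inj permutation)
  have "\<sigma> ` range (\<lambda>i. (\<sigma> ^^ i) b) = range (\<lambda>i. (\<sigma> ^^ i) b)"
  proof
    show "\<sigma> ` range (\<lambda>i. (\<sigma> ^^ i) b) \<subseteq> range (\<lambda>i. (\<sigma> ^^ i) b)"
      by (auto intro: range_eqI[of _ _ "Suc _"])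
    show "range (\<lambda>i. (\<sigma> ^^ i) b) \<subseteq> \<sigma> ` range (\<lambda>i. (\<sigma> ^^ i) b)"
    proof
      fix x assume "x \<in> range (\<lambda>i. (\<sigma> ^^ i) b)"
      then obtain i where x: "x = (\<sigma> ^^ i) b" by blast
      obtain m where m: "(\<sigma> ^^ m) = id" "m > 0"
        using permutation_is_nilpotent[OF assms(1)] by blast
      have "x = (\<sigma> ^^ (i + m)) b" unfolding funpow_add m x by simp
      also have "\<dots> = \<sigma> ((\<sigma> ^^ (i + m - 1)) b)" using m(2)
        by (metis add_gr_0 Suc_diff_1 funpow.simps(2) o_apply)
      finally show "x \<in> \<sigma> ` range (\<lambda>i. (\<sigma> ^^ i) b)" by blast
    qed
  qed
  then show ?thesis
    unfolding support_set[OF assms(1)] image_set_diff[OF inj] using assms(2) by simp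
qed

text \<open>All points of the orbit of \<open>b\<close> have the period of \<open>b\<close>, which is also their number.\<close>

lemma points_of_period_remove_orbit:
  assumes \<sigma>: "permutation \<sigma>" and A: "\<sigma> ` A = A" "finite A" and b: "b \<in> A"
  shows "card (points_of_period \<sigma> A j) =
    card (points_of_period \<sigma> (A - set (support \<sigma> b)) j) + (if j = least_power \<sigma> b then j else 0)"
proof -
  let ?O = "set (support \<sigma> b)"
  have OA: "?O \<subseteq> A" using funpow_image_closed[OF A(1) b] by auto
  have per: "least_power \<sigma> x = least_power \<sigma> b" if "x \<in> ?O" for x
    using that least_power_funpow[OF \<sigma>] by auto
  have eq: "points_of_period \<sigma> A j =
      points_of_period \<sigma> (A - ?O) j \<union> (if j = least_power \<sigma> b then ?O else {})"
  proof (rule Set.set_eqI)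
    fix x
    show "x \<in> points_of_period \<sigma> A j \<longleftrightarrow> x \<in> points_of_period \<sigma> (A - ?O) j \<union>
      (if j = least_power \<sigma> b then ?O else {})"
    proof (cases "x \<in> ?O")
      case True
      then have "x \<in> A" using OA by blast
      with True per[OF True] show ?thesis by (simp add: points_of_period_def del: set_map)
    next
      case False
      then show ?thesis by (simp add: points_of_period_def del: set_map)
    qed
  qed
  have fin: "finite (points_of_period \<sigma> (A - ?O) j)"
    using A(2) unfolding points_of_period_def by simp
  have "points_of_period \<sigma> (A - ?O) j \<inter> (if j = least_power \<sigma> b then ?O else {}) = {}"
    unfolding points_of_period_def by (auto simp del: set_map)
  then show ?thesis unfolding eq using fin
    by (subst card_Un_disjoint) (auto simp del: set_map simp: card_support[OF \<sigma>])
qed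

lemma has_cycle_type_remove_orbit:
  assumes "permutation \<sigma>" "\<sigma> ` A = A" "finite A" "b \<in> A" "least_power \<sigma> b = k"
  shows "has_cycle_type \<sigma> A (k # \<mu>) \<longleftrightarrow> has_cycle_type \<sigma> (A - set (support \<sigma> b)) \<mu>"
  unfolding has_cycle_type_def points_of_period_remove_orbit[OF assms(1-4)]
  using assms(5) by (auto simp: algebra_simps)

lemma has_cycle_type_empty [simp]: "has_cycle_type \<sigma> {} []"
  by (simp add: has_cycle_type_def points_of_period_def)

lemma has_cycle_type_Nil_iff:
  assumes "finite A"
  shows "has_cycle_type \<sigma> A [] \<longleftrightarrow> A = {}"
  using assms by (auto simp: has_cycle_type_def points_of_period_def)

lemma cycle_listings_distinct_set:
  assumes "permutation \<sigma>" "\<sigma> ` A = A" "xs \<in> cycle_listings \<sigma> \<mu> A"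
  shows "distinct xs \<and> set xs = A"
  using assms(2,3)
proof (induction \<mu> arbitrary: A xs)
  case Nil
  then show ?case by (auto split: if_splits)
next
  case (Cons k \<mu>)
  then obtain b ys where b: "b \<in> A" and ys: "ys \<in> cycle_listings \<sigma> \<mu> (A - set (support \<sigma> b))"
    and xs: "xs = support \<sigma> b @ ys"
    by (auto simp: points_of_period_def)
  have "distinct ys \<and> set ys = A - set (support \<sigma> b)"
    using Cons.IH[OF remove_orbit_closed[OF assms(1) Cons.prems(1)] ys] .
  moreover have "set (support \<sigma> b) \<subseteq> A" using funpow_image_closed[OF Cons.prems(1) b] by auto
  ultimately show ?case
    unfolding xs distinct_append set_append using cycle_of_permutation[OF assms(1), of b] by blast
qed

lemma hd_support: "permutation \<sigma> \<Longrightarrow> hd (support \<sigma> b) = b \<and> support \<sigma> b \<noteq> []"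
  using least_power_of_permutation(2)[of \<sigma> b] by (simp add: hd_map)

lemma finite_cycle_listings: "finite A \<Longrightarrow> finite (cycle_listings \<sigma> \<mu> A)"
  by (induction \<mu> arbitrary: A) (auto simp: points_of_period_def simp del: set_map)

text \<open>The one counting argument: a first cycle of length \<open>k\<close> can start at any of the \<open>k m\<^sub>k\<close>
  points of period \<open>k\<close>, and removing it lowers \<open>m\<^sub>k\<close> by one. These choices multiply up to the order
  of the centralizer. The same induction shows that there is no listing at all for a wrong cycle type,
  so it decides conjugacy as well. Lengths that do not occur contribute the factor \<open>1\<close>, which is why
  the product may extend over any finite \<open>K\<close> that contains the entries of \<open>\<mu>\<close>.\<close>

lemma card_cycle_listings:
  assumes \<sigma>: "permutation \<sigma>" and "\<sigma> ` A = A" "finite A" and "finite K" "set \<mu> \<subseteq> K" "0 \<notin> set \<mu>"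
  shows "card (cycle_listings \<sigma> \<mu> A) =
    (if has_cycle_type \<sigma> A \<mu> then \<Prod>k\<in>K. fact (count_list \<mu> k) * k ^ count_list \<mu> k else 0)"
  using assms(2-)
proof (induction \<mu> arbitrary: A)
  case Nil
  then show ?case by (simp add: has_cycle_type_Nil_iff)
next
  case (Cons k \<mu>)
  let ?P = "points_of_period \<sigma> A k"
  let ?d = "\<lambda>\<mu>. \<Prod>k\<in>K. fact (count_list \<mu> k) * k ^ count_list \<mu> k"
  let ?L = "\<lambda>b. (@) (support \<sigma> b) ` cycle_listings \<sigma> \<mu> (A - set (support \<sigma> b))"
  have finP: "finite ?P" using Cons.prems(2) by (simp add: points_of_period_def)
  \<comment> \<open>The pieces are disjoint because a listing remembers its starting point as its head.\<close>
  have hdL: "hd xs = b" if "xs \<in> ?L b" for xs b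
  proof -
    obtain ys where "xs = support \<sigma> b @ ys" using \<open>xs \<in> ?L b\<close> by blast
    then show ?thesis using hd_support[OF \<sigma>, of b] by (simp add: hd_append)
  qed
  have disj: "?L b \<inter> ?L c = {}" if "b \<noteq> c" for b c
  proof (rule ccontr)
    assume "?L b \<inter> ?L c \<noteq> {}"
    then obtain xs where "xs \<in> ?L b" "xs \<in> ?L c" by blast
    then show False using hdL[of xs b] hdL[of xs c] \<open>b \<noteq> c\<close> by simp
  qed
  have finL: "finite (?L b)" for b
    using finite_cycle_listings[of "A - set (support \<sigma> b)" \<sigma> \<mu>] Cons.prems(2) by blast
  have "card (cycle_listings \<sigma> (k # \<mu>) A) = (\<Sum>b\<in>?P. card (?L b))"
    unfolding cycle_listings.simps
    by (rule card_UN_disjoint[OF finP]) (use disj finL in blast)+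
  also have "\<dots> = (\<Sum>b\<in>?P. if has_cycle_type \<sigma> A (k # \<mu>) then ?d \<mu> else 0)"
  proof (rule sum.cong[OF refl])
    fix b assume "b \<in> ?P"
    then have b: "b \<in> A" "least_power \<sigma> b = k" by (auto simp: points_of_period_def)
    have "card (?L b) = card (cycle_listings \<sigma> \<mu> (A - set (support \<sigma> b)))"
      by (rule card_image) (auto simp: inj_on_def)
    also have "\<dots> = (if has_cycle_type \<sigma> (A - set (support \<sigma> b)) \<mu> then ?d \<mu> else 0)"
      using Cons.prems remove_orbit_closed[OF \<sigma> Cons.prems(1)] by (intro Cons.IH) auto
    finally show "card (?L b) = (if has_cycle_type \<sigma> A (k # \<mu>) then ?d \<mu> else 0)"
      using has_cycle_type_remove_orbit[OF \<sigma> Cons.prems(1,2) b] by simp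
  qed
  also have "\<dots> = (if has_cycle_type \<sigma> A (k # \<mu>) then card ?P * ?d \<mu> else 0)" by simp
  also have "\<dots> = (if has_cycle_type \<sigma> A (k # \<mu>) then ?d (k # \<mu>) else 0)"
  proof (cases "has_cycle_type \<sigma> A (k # \<mu>)")
    case True
    then have P: "card ?P = k * Suc (count_list \<mu> k)" by (simp add: has_cycle_type_def)
    have k: "k \<in> K" using Cons.prems by simp
    have rest: "(\<Prod>j\<in>K - {k}. fact (count_list (k # \<mu>) j) * j ^ count_list (k # \<mu>) j)
      = (\<Prod>j\<in>K - {k}. fact (count_list \<mu> j) * j ^ count_list \<mu> j)"
      by (intro prod.cong) auto
    have "?d (k # \<mu>) = card ?P * ?d \<mu>"
      unfolding prod.remove[OF Cons.prems(3) k] rest P by (simp add: algebra_simps)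
    then show ?thesis using True by simp
  qed simp
  finally show ?case .
qed

lemma cycle_of_upt:
  assumes "s \<le> i" "i < s + k"
  shows "cycle_of_list [s..<s + k] i = (if Suc i < s + k then Suc i else s)"
proof -
  have "map (cycle_of_list [s..<s + k]) [s..<s + k] = rotate1 [s..<s + k]"
    using cyclic_rotation[of "[s..<s + k]" 1] by simp
  then have "map (cycle_of_list [s..<s + k]) [s..<s + k] ! (i - s) = rotate1 [s..<s + k] ! (i - s)"
    by simp
  moreover have "Suc (i - s) mod k = (if Suc i < s + k then Suc (i - s) else 0)"
  proof (cases "Suc i < s + k")
    case False
    then have "Suc (i - s) = k" using assms by linarith
    then show ?thesis using False by simp
  qed (use assms in simp)
  ultimately show ?thesis using assms by (auto simp: nth_rotate1 split: if_splits)
qed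

lemma cycles_from_permutes: "cycles_from s \<mu> permutes {s..<s + sum_list \<mu>}"
proof (induction \<mu> arbitrary: s)
  case (Cons k \<mu>)
  have "cycle_of_list [s..<s + k] permutes {s..<s + sum_list (k # \<mu>)}"
    by (rule permutes_subset[OF cycle_permutes]) auto
  moreover have "cycles_from (s + k) \<mu> permutes {s..<s + sum_list (k # \<mu>)}"
    by (rule permutes_subset[OF Cons.IH]) (auto simp: algebra_simps)
  ultimately show ?case unfolding cycles_from.simps by (rule permutes_compose[rotated])
qed (simp add: permutes_id)

lemma cycles_from_Cons_less:
  assumes "s \<le> i" "i < s + k"
  shows "cycles_from s (k # \<mu>) i = (if Suc i < s + k then Suc i else s)"
  using permutes_not_in[OF cycles_from_permutes[of "s + k" \<mu>], of i] cycle_of_upt[OF assms] assms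
  by simp

lemma cycles_from_Cons_ge:
  assumes "s + k \<le> i"
  shows "cycles_from s (k # \<mu>) i = cycles_from (s + k) \<mu> i"
proof -
  have "s + k \<le> cycles_from (s + k) \<mu> i"
  proof (cases "i < s + k + sum_list \<mu>")
    case True
    then show ?thesis
      using permutes_in_image[OF cycles_from_permutes[of "s + k" \<mu>], of i] assms by simp
  next
    case False
    then show ?thesis
      using permutes_not_in[OF cycles_from_permutes[of "s + k" \<mu>], of i] assms by simp
  qed
  then show ?thesis by (simp add: id_outside_supp)
qed

text \<open>On a block of consecutive numbers, \<open>\<tau>\<close> intertwines the cyclic shift with \<open>\<sigma>\<close> iff its values are
  the successive iterates of \<open>\<sigma>\<close>. Injectivity of \<open>\<tau>\<close> keeps the period of the first value from being a
  proper divisor of the length of the block.\<close>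

lemma map_upt_eq_support_iff:
  assumes \<sigma>: "permutation \<sigma>" and k: "0 < k" and inj: "inj_on \<tau> {s..<s + k}"
  shows "map \<tau> [s..<s + k] = support \<sigma> (\<tau> s) \<longleftrightarrow>
    (\<forall>i\<in>{s..<s + k}. \<tau> (if Suc i < s + k then Suc i else s) = \<sigma> (\<tau> i))"
proof
  assume eq: "map \<tau> [s..<s + k] = support \<sigma> (\<tau> s)"
  have per: "least_power \<sigma> (\<tau> s) = k" using arg_cong[OF eq, of length] by simp
  have \<tau>: "\<tau> (s + j) = (\<sigma> ^^ j) (\<tau> s)" if "j < k" for j
    using arg_cong[OF eq, of "\<lambda>xs. xs ! j"] that per by simp
  show "\<forall>i\<in>{s..<s + k}. \<tau> (if Suc i < s + k then Suc i else s) = \<sigma> (\<tau> i)"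
  proof
    fix i assume "i \<in> {s..<s + k}"
    then obtain j where j: "i = s + j" "j < k" using le_Suc_ex by fastforce
    show "\<tau> (if Suc i < s + k then Suc i else s) = \<sigma> (\<tau> i)"
    proof (cases "Suc j < k")
      case True
      then show ?thesis using \<tau>[OF j(2)] \<tau>[OF True] j by simp
    next
      case False
      then have "Suc j = k" using j by simp
      then have "\<sigma> (\<tau> i) = (\<sigma> ^^ k) (\<tau> s)" using \<tau>[OF j(2)] j by auto
      then show ?thesis using least_power_of_permutation(1)[OF \<sigma>, of "\<tau> s"] per False j by simp
    qed
  qed
next
  assume eq: "\<forall>i\<in>{s..<s + k}. \<tau> (if Suc i < s + k then Suc i else s) = \<sigma> (\<tau> i)"
  have \<tau>: "\<tau> (s + j) = (\<sigma> ^^ j) (\<tau> s)" if "j < k" for j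
    using that
  proof (induction j)
    case (Suc j)
    then show ?case using bspec[OF eq, of "s + j"] by simp
  qed simp
  have "(\<sigma> ^^ k) (\<tau> s) = \<sigma> ((\<sigma> ^^ (k - 1)) (\<tau> s))"
    using k by (metis Suc_diff_1 funpow.simps(2) o_apply)
  also have "\<dots> = \<tau> s" using bspec[OF eq, of "s + (k - 1)"] \<tau>[of "k - 1"] k by simp
  finally have "least_power \<sigma> (\<tau> s) \<le> k" using k by (rule least_power_le)
  moreover have "\<not> least_power \<sigma> (\<tau> s) < k"
  proof
    assume less: "least_power \<sigma> (\<tau> s) < k"
    then have "\<tau> (s + least_power \<sigma> (\<tau> s)) = \<tau> s"
      using \<tau> least_power_of_permutation(1)[OF \<sigma>] by simp
    then show False using inj_onD[OF inj] less k least_power_of_permutation(2)[OF \<sigma>, of "\<tau> s"] by force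
  qed
  ultimately have "least_power \<sigma> (\<tau> s) = k" by simp
  then show "map \<tau> [s..<s + k] = support \<sigma> (\<tau> s)"
    using \<tau> by (intro nth_equalityI) auto
qed

text \<open>The standard permutation shifts each of its blocks cyclically, so the condition that \<open>\<tau>\<close>
  intertwines it with \<open>\<sigma>\<close> splits into one condition for the first block and one for the rest.\<close>

lemma map_upt_in_cycle_listings_iff:
  assumes \<sigma>: "permutation \<sigma>" and "0 \<notin> set \<mu>"
    and "inj_on \<tau> {s..<s + sum_list \<mu>}" "\<tau> ` {s..<s + sum_list \<mu>} = A"
  shows "map \<tau> [s..<s + sum_list \<mu>] \<in> cycle_listings \<sigma> \<mu> A \<longleftrightarrow>
    (\<forall>i\<in>{s..<s + sum_list \<mu>}. \<tau> (cycles_from s \<mu> i) = \<sigma> (\<tau> i))"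
  using assms(2-)
proof (induction \<mu> arbitrary: s A)
  case (Cons k \<mu>)
  let ?m = "sum_list \<mu>"
  have k: "0 < k" using Cons.prems(1) by auto
  have upt: "[s..<s + sum_list (k # \<mu>)] = [s..<s + k] @ [s + k..<s + k + ?m]"
    using upt_add_eq_append[of s "s + k" ?m] by (simp add: add.assoc)
  have ivl: "{s..<s + sum_list (k # \<mu>)} = {s..<s + k} \<union> {s + k..<s + k + ?m}" by auto
  have inj1: "inj_on \<tau> {s..<s + k}" and inj2: "inj_on \<tau> {s + k..<s + k + ?m}"
    using Cons.prems(2) unfolding ivl by (auto simp: inj_on_Un)
  have A: "A = \<tau> ` {s..<s + k} \<union> \<tau> ` {s + k..<s + k + ?m}"
    using Cons.prems(3) unfolding ivl by auto
  have rest: "A - set (map \<tau> [s..<s + k]) = \<tau> ` {s + k..<s + k + ?m}"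
  proof -
    have "A - \<tau> ` {s..<s + k} = \<tau> ` ({s..<s + sum_list (k # \<mu>)} - {s..<s + k})"
      unfolding Cons.prems(3)[symmetric]
      by (rule inj_on_image_set_diff[OF Cons.prems(2), symmetric]) auto
    also have "{s..<s + sum_list (k # \<mu>)} - {s..<s + k} = {s + k..<s + k + ?m}" by auto
    finally show ?thesis by simp
  qed
  have hd: "hd (map \<tau> [s..<s + k] @ zs) = \<tau> s" for zs using k by (simp add: hd_append hd_map)
  have "map \<tau> [s..<s + sum_list (k # \<mu>)] \<in> cycle_listings \<sigma> (k # \<mu>) A \<longleftrightarrow>
    map \<tau> [s..<s + k] = support \<sigma> (\<tau> s) \<and>
    map \<tau> [s + k..<s + k + ?m] \<in> cycle_listings \<sigma> \<mu> (\<tau> ` {s + k..<s + k + ?m})"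
    (is "?l \<longleftrightarrow> ?r")
  proof
    assume ?l
    then obtain b zs where b: "b \<in> A" "least_power \<sigma> b = k"
      and zs: "zs \<in> cycle_listings \<sigma> \<mu> (A - set (support \<sigma> b))"
      and eq: "map \<tau> [s..<s + k] @ map \<tau> [s + k..<s + k + ?m] = support \<sigma> b @ zs"
      unfolding upt map_append cycle_listings.simps points_of_period_def by blast
    have "b = \<tau> s"
      using arg_cong[OF eq, of hd] hd_support[OF \<sigma>, of b] unfolding hd by (simp add: hd_append)
    moreover have split: "map \<tau> [s..<s + k] = support \<sigma> b" "map \<tau> [s + k..<s + k + ?m] = zs"
      using eq b(2) by (auto simp: append_eq_append_conv)
    ultimately show ?r using zs rest by metis
  next
    assume r: ?r
    have "least_power \<sigma> (\<tau> s) = k" using arg_cong[OF conjunct1[OF r], of length] by simp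
    moreover have "\<tau> s \<in> A" unfolding A using k by auto
    ultimately have "\<tau> s \<in> points_of_period \<sigma> A k" by (simp add: points_of_period_def)
    moreover have "map \<tau> [s + k..<s + k + ?m] \<in> cycle_listings \<sigma> \<mu> (A - set (support \<sigma> (\<tau> s)))"
      using r rest by metis
    ultimately show ?l unfolding upt map_append cycle_listings.simps conjunct1[OF r] by blast
  qed
  also have "map \<tau> [s + k..<s + k + ?m] \<in> cycle_listings \<sigma> \<mu> (\<tau> ` {s + k..<s + k + ?m}) \<longleftrightarrow>
      (\<forall>i\<in>{s + k..<s + k + ?m}. \<tau> (cycles_from (s + k) \<mu> i) = \<sigma> (\<tau> i))"
    using Cons.prems inj2 by (intro Cons.IH) auto
  also have "map \<tau> [s..<s + k] = support \<sigma> (\<tau> s) \<longleftrightarrow>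
      (\<forall>i\<in>{s..<s + k}. \<tau> (if Suc i < s + k then Suc i else s) = \<sigma> (\<tau> i))"
    by (rule map_upt_eq_support_iff[OF \<sigma> k inj1])
  also have "\<dots> \<longleftrightarrow> (\<forall>i\<in>{s..<s + k}. \<tau> (cycles_from s (k # \<mu>) i) = \<sigma> (\<tau> i))"
    by (intro ball_cong refl) (simp only: cycles_from_Cons_less atLeastLessThan_iff)
  also have "(\<forall>i\<in>{s + k..<s + k + ?m}. \<tau> (cycles_from (s + k) \<mu> i) = \<sigma> (\<tau> i)) \<longleftrightarrow>
      (\<forall>i\<in>{s + k..<s + k + ?m}. \<tau> (cycles_from s (k # \<mu>) i) = \<sigma> (\<tau> i))"
    by (intro ball_cong refl) (simp only: cycles_from_Cons_ge atLeastLessThan_iff)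
  finally show ?case unfolding ivl ball_Un .
qed simp

lemma partition_perm_permutes:
  "\<mu> \<in> partitions n \<Longrightarrow> partition_perm \<mu> permutes {0..<n}"
  using cycles_from_permutes[of 0 \<mu>] by (simp add: partitions_def partition_perm_def)

lemma partition_part_le: "\<mu> \<in> partitions n \<Longrightarrow> k \<in> set \<mu> \<Longrightarrow> 1 \<le> k \<and> k \<le> n"
  using member_le_sum_list[of k \<mu>] by (auto simp: partitions_def)

lemma finite_partitions: "finite (partitions n)"
proof (rule finite_subset)
  have len: "length \<mu> \<le> sum_list \<mu>" if "\<forall>k\<in>set \<mu>. 0 < k" for \<mu> :: "nat list"
    using that by (induction \<mu>) auto
  show "partitions n \<subseteq> {\<mu>. set \<mu> \<subseteq> {0..n} \<and> length \<mu> \<le> n}"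
  proof
    fix \<mu> assume \<mu>: "\<mu> \<in> partitions n"
    then have "length \<mu> \<le> n" using len[of \<mu>] by (simp add: partitions_def)
    then show "\<mu> \<in> {\<mu>. set \<mu> \<subseteq> {0..n} \<and> length \<mu> \<le> n}"
      using partition_part_le[OF \<mu>] by auto
  qed
  show "finite {\<mu>::nat list. set \<mu> \<subseteq> {0..n} \<and> length \<mu> \<le> n}"
    by (rule finite_lists_length_le) simp
qed

text \<open>For \<open>\<sigma>\<close> the standard permutation itself this is the order of its centralizer.\<close>

lemma card_conjugators:
  assumes \<sigma>: "\<sigma> permutes {0..<n}" and \<mu>: "\<mu> \<in> partitions n"
  shows "card {\<tau>. \<tau> permutes {0..<n} \<and> \<tau> \<circ> partition_perm \<mu> \<circ> inv_into UNIV \<tau> = \<sigma>} =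
    (if has_cycle_type \<sigma> {0..<n} \<mu> then d_coeff n \<mu> else 0)"
proof -
  let ?C = "{\<tau>. \<tau> permutes {0..<n} \<and> \<tau> \<circ> partition_perm \<mu> \<circ> inv_into UNIV \<tau> = \<sigma>}"
  have p\<sigma>: "permutation \<sigma>" using \<sigma> permutation_permutes by blast
  have sum: "sum_list \<mu> = n" and pos: "0 \<notin> set \<mu>" using \<mu> by (auto simp: partitions_def)
  have im: "\<sigma> ` {0..<n} = {0..<n}" by (rule permutes_image[OF \<sigma>])
  have iff: "\<tau> \<in> ?C \<longleftrightarrow> map \<tau> [0..<n] \<in> cycle_listings \<sigma> \<mu> {0..<n}" if \<tau>: "\<tau> permutes {0..<n}" for \<tau>
  proof -
    have "\<tau> \<circ> partition_perm \<mu> \<circ> inv_into UNIV \<tau> = \<sigma> \<longleftrightarrow> \<tau> \<circ> partition_perm \<mu> = \<sigma> \<circ> \<tau>"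
      using permutes_inv_o[OF \<tau>] by (metis comp_assoc comp_id)
    also have "\<dots> \<longleftrightarrow> (\<forall>i\<in>{0..<n}. \<tau> (partition_perm \<mu> i) = \<sigma> (\<tau> i))"
    proof -
      have "\<tau> (partition_perm \<mu> i) = \<sigma> (\<tau> i)" if "i \<notin> {0..<n}" for i
        using that permutes_not_in[OF \<tau>] permutes_not_in[OF \<sigma>]
          permutes_not_in[OF partition_perm_permutes[OF \<mu>]] by metis
      then show ?thesis unfolding fun_eq_iff comp_apply by metis
    qed
    also have "\<dots> \<longleftrightarrow> map \<tau> [0..<n] \<in> cycle_listings \<sigma> \<mu> {0..<n}"
      using map_upt_in_cycle_listings_iff[OF p\<sigma> pos, of \<tau> 0 "{0..<n}"] permutes_inj_on[OF \<tau>]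
        permutes_image[OF \<tau>]
      by (simp add: sum partition_perm_def)
    finally show ?thesis using \<tau> by simp
  qed
  have "bij_betw (\<lambda>\<tau>. map \<tau> [0..<n]) ?C (cycle_listings \<sigma> \<mu> {0..<n})"
  proof (rule bij_betwI')
    fix \<tau> \<tau>' assume "\<tau> \<in> ?C" "\<tau>' \<in> ?C"
    then have t: "\<tau> permutes {0..<n}" "\<tau>' permutes {0..<n}" by auto
    have "\<tau> = \<tau>'" if "map \<tau> [0..<n] = map \<tau>' [0..<n]"
    proof
      fix i show "\<tau> i = \<tau>' i"
        using that permutes_not_in[OF t(1), of i] permutes_not_in[OF t(2), of i]
        by (cases "i < n") (auto simp: map_eq_conv)
    qed
    then show "map \<tau> [0..<n] = map \<tau>' [0..<n] \<longleftrightarrow> \<tau> = \<tau>'" by auto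
  next
    fix \<tau> assume "\<tau> \<in> ?C"
    then show "map \<tau> [0..<n] \<in> cycle_listings \<sigma> \<mu> {0..<n}" using iff[of \<tau>] by blast
  next
    fix xs assume xs: "xs \<in> cycle_listings \<sigma> \<mu> {0..<n}"
    have dist: "distinct xs" "set xs = {0..<n}"
      using cycle_listings_distinct_set[OF p\<sigma> im xs] by auto
    then have len: "length xs = n" using distinct_card by fastforce
    define \<tau> where "\<tau> = (\<lambda>i. if i < n then xs ! i else i)"
    have "bij_betw \<tau> {0..<n} {0..<n}"
      using bij_betw_nth[OF dist(1), of "{0..<n}" "{0..<n}"] dist(2) len
      by (subst bij_betw_cong[of _ _ "(!) xs"]) (auto simp: \<tau>_def atLeast0LessThan)
    then have \<tau>: "\<tau> permutes {0..<n}"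
      by (rule bij_imp_permutes) (auto simp: \<tau>_def)
    have map: "xs = map \<tau> [0..<n]" using len by (intro nth_equalityI) (auto simp: \<tau>_def)
    then show "\<exists>\<tau>\<in>?C. xs = map \<tau> [0..<n]" using iff[OF \<tau>] xs by blast
  qed
  then have "card ?C = card (cycle_listings \<sigma> \<mu> {0..<n})" by (rule bij_betw_same_card)
  also have "\<dots> = (if has_cycle_type \<sigma> {0..<n} \<mu> then d_coeff n \<mu> else 0)"
    unfolding d_coeff_def using partition_part_le[OF \<mu>] pos im
    by (intro card_cycle_listings[OF p\<sigma>]) auto
  finally show ?thesis .
qed

text \<open>Split off one orbit at a time.\<close>

lemma has_cycle_type_exists:
  assumes \<sigma>: "permutation \<sigma>" and "\<sigma> ` A = A" "finite A"
  shows "\<exists>\<mu>. has_cycle_type \<sigma> A \<mu> \<and> sum_list \<mu> = card A \<and> 0 \<notin> set \<mu>"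
  using assms(3,2)
proof (induction A rule: finite_psubset_induct)
  case (psubset A)
  show ?case
  proof (cases "A = {}")
    case True
    then show ?thesis by (intro exI[of _ "[]"]) simp
  next
    case False
    then obtain b where b: "b \<in> A" by blast
    let ?O = "set (support \<sigma> b)"
    have OA: "?O \<subseteq> A" using funpow_image_closed[OF psubset.prems b] by auto
    have bO: "b \<in> ?O" using hd_support[OF \<sigma>, of b] hd_in_set[of "support \<sigma> b"] by simp
    have "A - ?O \<subset> A" using b bO by blast
    from psubset.IH[OF this remove_orbit_closed[OF \<sigma> psubset.prems]] obtain \<mu> where \<mu>: "has_cycle_type \<sigma> (A - ?O) \<mu>" "sum_list \<mu> = card (A - ?O)" "0 \<notin> set \<mu>"
      by (elim exE conjE)
    have "has_cycle_type \<sigma> A (least_power \<sigma> b # \<mu>)"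
      using has_cycle_type_remove_orbit[OF \<sigma> psubset.prems psubset.hyps b refl] \<mu>(1) by simp
    moreover have "sum_list (least_power \<sigma> b # \<mu>) = card A"
      using \<mu>(2) card_Diff_subset[OF _ OA] card_mono[OF psubset.hyps OA] card_support[OF \<sigma>, of b]
      by simp
    moreover have "0 \<notin> set (least_power \<sigma> b # \<mu>)"
      using \<mu>(3) least_power_of_permutation(2)[OF \<sigma>, of b] by simp
    ultimately show ?thesis by blast
  qed
qed

lemma ex1_partition_cycle_type:
  assumes \<sigma>: "\<sigma> permutes {0..<n}"
  shows "\<exists>!\<mu>. \<mu> \<in> partitions n \<and> has_cycle_type \<sigma> {0..<n} \<mu>"
proof (rule ex_ex1I)
  have "permutation \<sigma>" using \<sigma> permutation_permutes by blast
  then obtain \<mu> where \<mu>: "has_cycle_type \<sigma> {0..<n} \<mu>" "sum_list \<mu> = n" "0 \<notin> set \<mu>"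
    using has_cycle_type_exists[OF _ permutes_image[OF \<sigma>]] by auto
  have "count_list (sort \<mu>) = count_list \<mu>"
    by (metis count_mset ext mset_sort)
  moreover have "sum_list (sort \<mu>) = sum_list \<mu>" by (metis mset_sort sum_mset_sum_list)
  moreover have "\<forall>k\<in>set (sort \<mu>). 0 < k" using \<mu>(3) by (auto intro: Nat.gr0I)
  ultimately show "\<exists>\<mu>. \<mu> \<in> partitions n \<and> has_cycle_type \<sigma> {0..<n} \<mu>"
    using \<mu> by (intro exI[of _ "sort \<mu>"]) (simp add: partitions_def has_cycle_type_def)
next
  fix \<mu> \<nu>
  assume \<mu>: "\<mu> \<in> partitions n \<and> has_cycle_type \<sigma> {0..<n} \<mu>"
    and \<nu>: "\<nu> \<in> partitions n \<and> has_cycle_type \<sigma> {0..<n} \<nu>"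
  have "count_list \<mu> k = count_list \<nu> k" for k
  proof (cases "k = 0")
    case True
    then have "k \<notin> set \<mu>" "k \<notin> set \<nu>" using \<mu> \<nu> by (auto simp: partitions_def)
    then show ?thesis by (simp add: count_list_0_iff)
  next
    case False
    then show ?thesis using \<mu> \<nu> unfolding has_cycle_type_def by (metis mult_cancel1)
  qed
  then have "mset \<mu> = mset \<nu>" by (intro multiset_eqI) (simp add: count_mset)
  then show "\<mu> = \<nu>" using \<mu> \<nu>
    by (metis (mono_tags, lifting) mem_Collect_eq partitions_def properties_for_sort)
qed

text \<open>If \<open>\<tau>\<close> runs through the symmetric group, the conjugate by \<open>\<tau>\<close> of the standard permutation of type
  \<open>\<mu>\<close> equals each permutation of that type \<open>d(\<mu>)\<close> times and no other, which avoids computing the size of a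
  conjugacy class. As every permutation has exactly one type, summing over \<open>\<mu>\<close> gives the whole
  group.\<close>

lemma sum_class_function:
  fixes h :: "(nat \<Rightarrow> nat) \<Rightarrow> real"
  assumes h: "\<And>\<sigma> \<tau>. \<sigma> permutes {0..<n} \<Longrightarrow> \<tau> permutes {0..<n} \<Longrightarrow> h (\<tau> \<circ> \<sigma> \<circ> inv_into UNIV \<tau>) = h \<sigma>"
  shows "(\<Sum>\<sigma> | \<sigma> permutes {0..<n}. h \<sigma>) =
    fact n * (\<Sum>\<mu>\<in>partitions n. h (partition_perm \<mu>) / real (d_coeff n \<mu>))"
proof -
  let ?S = "{\<sigma>. \<sigma> permutes {0..<n}}"
  have finS: "finite ?S" by (rule finite_permutations) simp
  have d: "d_coeff n \<mu> \<noteq> 0" for \<mu> unfolding d_coeff_def by (simp add: prod_zero_iff)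
  have one: "fact n * (h (partition_perm \<mu>) / real (d_coeff n \<mu>)) =
      (\<Sum>\<sigma>\<in>?S. if has_cycle_type \<sigma> {0..<n} \<mu> then h \<sigma> else 0)"
    if \<mu>: "\<mu> \<in> partitions n" for \<mu>
  proof -
    let ?p = "partition_perm \<mu>"
    have p: "?p permutes {0..<n}" by (rule partition_perm_permutes[OF \<mu>])
    have "fact n * h ?p = (\<Sum>\<tau>\<in>?S. h ?p)" using card_permutations[of "{0..<n}" n] by simp
    also have "\<dots> = (\<Sum>\<tau>\<in>?S. h (\<tau> \<circ> ?p \<circ> inv_into UNIV \<tau>))" using h[OF p] by (intro sum.cong) auto
    also have "\<dots> = (\<Sum>\<sigma>\<in>?S. \<Sum>\<tau> | \<tau> \<in> ?S \<and> \<tau> \<circ> ?p \<circ> inv_into UNIV \<tau> = \<sigma>. h (\<tau> \<circ> ?p \<circ> inv_into UNIV \<tau>))"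
      using p finS by (intro sum.group[symmetric]) (auto intro!: permutes_compose permutes_inv)
    also have "\<dots> = (\<Sum>\<sigma>\<in>?S. if has_cycle_type \<sigma> {0..<n} \<mu> then d_coeff n \<mu> * h \<sigma> else 0)"
    proof (rule sum.cong[OF refl])
      fix \<sigma> assume \<sigma>: "\<sigma> \<in> ?S"
      have "(\<Sum>\<tau> | \<tau> \<in> ?S \<and> \<tau> \<circ> ?p \<circ> inv_into UNIV \<tau> = \<sigma>. h (\<tau> \<circ> ?p \<circ> inv_into UNIV \<tau>)) =
        (\<Sum>\<tau> | \<tau> \<in> ?S \<and> \<tau> \<circ> ?p \<circ> inv_into UNIV \<tau> = \<sigma>. h \<sigma>)" by (intro sum.cong) auto
      then show "(\<Sum>\<tau> | \<tau> \<in> ?S \<and> \<tau> \<circ> ?p \<circ> inv_into UNIV \<tau> = \<sigma>. h (\<tau> \<circ> ?p \<circ> inv_into UNIV \<tau>)) =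
        (if has_cycle_type \<sigma> {0..<n} \<mu> then d_coeff n \<mu> * h \<sigma> else 0)"
        using card_conjugators[OF _ \<mu>, of \<sigma>] \<sigma> by simp
    qed
    also have "\<dots> = (\<Sum>\<sigma>\<in>?S. if has_cycle_type \<sigma> {0..<n} \<mu> then h \<sigma> else 0) * d_coeff n \<mu>"
      by (subst sum_distrib_right) (auto intro!: sum.cong)
    finally show ?thesis using d[of \<mu>] by (simp add: field_simps)
  qed
  have "fact n * (\<Sum>\<mu>\<in>partitions n. h (partition_perm \<mu>) / real (d_coeff n \<mu>)) =
      (\<Sum>\<mu>\<in>partitions n. \<Sum>\<sigma>\<in>?S. if has_cycle_type \<sigma> {0..<n} \<mu> then h \<sigma> else 0)"
    unfolding sum_distrib_left by (intro sum.cong refl one)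
  also have "\<dots> = (\<Sum>\<sigma>\<in>?S. \<Sum>\<mu>\<in>partitions n. if has_cycle_type \<sigma> {0..<n} \<mu> then h \<sigma> else 0)"
    by (rule sum.swap)
  also have "\<dots> = (\<Sum>\<sigma>\<in>?S. h \<sigma>)"
  proof (rule sum.cong[OF refl])
    fix \<sigma> assume "\<sigma> \<in> ?S"
    then obtain \<mu> where \<mu>: "\<mu> \<in> partitions n" 
      and iff: "\<And>\<nu>. \<nu> \<in> partitions n \<Longrightarrow> has_cycle_type \<sigma> {0..<n} \<nu> \<longleftrightarrow> \<nu> = \<mu>"
      using ex1_partition_cycle_type[of \<sigma> n] by blast
    have "(\<Sum>\<nu>\<in>partitions n. if has_cycle_type \<sigma> {0..<n} \<nu> then h \<sigma> else 0) =
      (\<Sum>\<nu>\<in>partitions n. if \<nu> = \<mu> then h \<sigma> else 0)" using iff by (intro sum.cong) auto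
    then show "(\<Sum>\<nu>\<in>partitions n. if has_cycle_type \<sigma> {0..<n} \<nu> then h \<sigma> else 0) = h \<sigma>"
      using \<mu> finite_partitions by simp
  qed
  finally show ?thesis by simp
qed

section \<open>Monomial matrices\<close>

text \<open>The normal form of \<open>\<sigma> t\<close>, in which products, inverses and squares of entries can be
  read off without splitting a matrix into its two factors.\<close>

definition mono_mat :: "nat \<Rightarrow> (nat \<Rightarrow> nat) \<Rightarrow> (nat \<Rightarrow> 'a) \<Rightarrow> 'a::field mat" where
  "mono_mat n \<sigma> d = mat n n (\<lambda>(i, j). if i = \<sigma> j then d j else 0)"

lemma mono_mat_carrier [simp]: "mono_mat n \<sigma> d \<in> carrier_mat n n"
  by (simp add: mono_mat_def)

lemma mono_mat_cong:
  "(\<And>j. j < n \<Longrightarrow> \<sigma> j = \<tau> j) \<Longrightarrow> (\<And>j. j < n \<Longrightarrow> d j = e j) \<Longrightarrow> mono_mat n \<sigma> d = mono_mat n \<tau> e"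
  by (rule eq_matI) (auto simp: mono_mat_def)

lemma mono_mat_mult:
  assumes "\<tau> permutes {0..<n}"
  shows "mono_mat n \<sigma> d * mono_mat n \<tau> e = mono_mat n (\<sigma> \<circ> \<tau>) (\<lambda>j. d (\<tau> j) * e j)"
proof (rule eq_matI)
  fix i j assume "i < dim_row (mono_mat n (\<sigma> \<circ> \<tau>) (\<lambda>j. d (\<tau> j) * e j))"
    "j < dim_col (mono_mat n (\<sigma> \<circ> \<tau>) (\<lambda>j. d (\<tau> j) * e j))"
  then have ij: "i < n" "j < n" by (auto simp: mono_mat_def)
  have \<tau>j: "\<tau> j < n" using permutes_in_image[OF assms, of j] ij(2) by simp
  have "(mono_mat n \<sigma> d * mono_mat n \<tau> e) $$ (i, j) =
      (\<Sum>k = 0..<n. (if i = \<sigma> k then d k else 0) * (if k = \<tau> j then e j else 0))"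
    using ij by (simp add: mono_mat_def scalar_prod_def)
  also have "\<dots> = (\<Sum>k = 0..<n. if k = \<tau> j then (if i = \<sigma> k then d k else 0) * e j else 0)"
    by (rule sum.cong) auto
  also have "\<dots> = (if i = \<sigma> (\<tau> j) then d (\<tau> j) * e j else 0)" using \<tau>j by simp
  finally show "(mono_mat n \<sigma> d * mono_mat n \<tau> e) $$ (i, j) =
      mono_mat n (\<sigma> \<circ> \<tau>) (\<lambda>j. d (\<tau> j) * e j) $$ (i, j)"
    using ij by (simp add: mono_mat_def)
qed (auto simp: mono_mat_def)

lemma mono_mat_one: "mono_mat n id (\<lambda>_. 1) = 1\<^sub>m n"
  by (rule eq_matI) (auto simp: mono_mat_def)

lemma perm_mat_eq_mono_mat: "perm_mat n \<sigma> = mono_mat n \<sigma> (\<lambda>_. 1)"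
  by (simp add: perm_mat_def mono_mat_def)

lemma diagonal_mat_eq_mono_mat:
  assumes "t \<in> carrier_mat n n" "diagonal_mat t"
  shows "t = mono_mat n id (\<lambda>j. t $$ (j, j))"
  by (rule eq_matI) (use assms in \<open>auto simp: mono_mat_def diagonal_mat_def\<close>)

section \<open>The general linear group\<close>

lemma group_GL: "group (GL n :: 'a::field mat monoid)"
proof -
  interpret R: ring "ring_mat TYPE('a) n ()" by (rule ring_mat)
  show ?thesis unfolding GL_def by (rule R.units_group)
qed

lemma mult_GL [simp]: "monoid.mult (GL n) = (*)" and one_GL [simp]: "monoid.one (GL n) = 1\<^sub>m n"
  by (simp_all add: GL_def units_of_def ring_mat_simps)

lemma carrier_GL:
  "carrier (GL n) = {A \<in> carrier_mat n n. \<exists>B \<in> carrier_mat n n. B * A = 1\<^sub>m n \<and> A * B = 1\<^sub>m n}"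
  by (auto simp: GL_def units_of_def Units_def ring_mat_simps)

lemma GL_carrier_mat: "A \<in> carrier (GL n) \<Longrightarrow> A \<in> carrier_mat n n"
  by (simp add: carrier_GL)

lemma mono_mat_in_GL:
  fixes d :: "nat \<Rightarrow> 'a::field"
  assumes \<sigma>: "\<sigma> permutes {0..<n}" and d: "\<And>j. j < n \<Longrightarrow> d j \<noteq> 0"
  shows "mono_mat n \<sigma> d \<in> carrier (GL n)"
proof -
  let ?s = "inv_into UNIV \<sigma>"
  let ?B = "mono_mat n ?s (\<lambda>j. inverse (d (?s j)))"
  have s: "?s permutes {0..<n}" by (rule permutes_inv[OF \<sigma>])
  have lt: "?s j < n" if "j < n" for j using permutes_in_image[OF s, of j] that by simp
  have "?B * mono_mat n \<sigma> d = mono_mat n id (\<lambda>_. 1)"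
    unfolding mono_mat_mult[OF \<sigma>] permutes_inv_o(2)[OF \<sigma>]
    by (rule mono_mat_cong) (auto simp: permutes_inverses[OF \<sigma>] d)
  moreover have "mono_mat n \<sigma> d * ?B = mono_mat n id (\<lambda>_. 1)"
    unfolding mono_mat_mult[OF s] permutes_inv_o(1)[OF \<sigma>]
    by (rule mono_mat_cong) (auto simp: d lt)
  ultimately show ?thesis unfolding carrier_GL mono_mat_one by (auto intro!: bexI[of _ ?B])
qed

lemma perm_mat_in_GL: "\<sigma> permutes {0..<n} \<Longrightarrow> perm_mat n \<sigma> \<in> carrier (GL n)"
  unfolding perm_mat_eq_mono_mat by (rule mono_mat_in_GL) auto

lemma diag_subgroup_eq: "diag_subgroup n = {mono_mat n id d | d. \<forall>j<n. d j \<noteq> 0}"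
proof (intro Set.equalityI subsetI)
  fix t :: "'a mat" assume t: "t \<in> diag_subgroup n"
  then have "t = mono_mat n id (\<lambda>j. t $$ (j, j))"
    by (intro diagonal_mat_eq_mono_mat) (auto simp: diag_subgroup_def GL_carrier_mat)
  then show "t \<in> {mono_mat n id d | d. \<forall>j<n. d j \<noteq> 0}"
    using diag_subgroup_nonzero[OF t] by blast
next
  fix t :: "'a mat" assume "t \<in> {mono_mat n id d | d. \<forall>j<n. d j \<noteq> 0}"
  then obtain d where t: "t = mono_mat n id d" "\<forall>j<n. d j \<noteq> 0" by blast
  then have "t \<in> carrier (GL n)" by (auto intro: mono_mat_in_GL permutes_id)
  moreover have "diagonal_mat t" by (auto simp: t(1) mono_mat_def diagonal_mat_def)
  ultimately show "t \<in> diag_subgroup n" by (simp add: diag_subgroup_def)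
qed

lemma perm_mat_mult_diag: "perm_mat n \<sigma> * mono_mat n id d = mono_mat n \<sigma> d"
  unfolding perm_mat_eq_mono_mat by (subst mono_mat_mult) (auto simp: permutes_id)

lemma monomial_group_carrier:
  "carrier (monomial_group n) = {mono_mat n \<sigma> d | \<sigma> d. \<sigma> permutes {0..<n} \<and> (\<forall>j<n. d j \<noteq> 0)}"
proof -
  have "carrier (monomial_group n) =
      {perm_mat n \<sigma> * mono_mat n id d | \<sigma> d. \<sigma> permutes {0..<n} \<and> (\<forall>j<n. d j \<noteq> 0)}"
    unfolding monomial_group_def diag_subgroup_eq by auto
  then show ?thesis unfolding perm_mat_mult_diag .
qed

lemma mono_mat_in_monomial_group:
  "\<sigma> permutes {0..<n} \<Longrightarrow> \<forall>j<n. d j \<noteq> 0 \<Longrightarrow> mono_mat n \<sigma> d \<in> carrier (monomial_group n)"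
  unfolding monomial_group_carrier by blast

lemma monomial_subgroup: "subgroup (carrier (monomial_group n)) (GL n :: 'a::field mat monoid)"
proof -
  interpret G: group "GL n :: 'a mat monoid" by (rule group_GL)
  show ?thesis
  proof (rule G.subgroupI)
    show "carrier (monomial_group n) \<subseteq> carrier (GL n :: 'a mat monoid)"
      unfolding monomial_group_carrier by (auto intro: mono_mat_in_GL)
    have "1\<^sub>m n \<in> (carrier (monomial_group n) :: 'a mat set)"
      unfolding mono_mat_one[symmetric] by (rule mono_mat_in_monomial_group) (auto intro: permutes_id)
    then show "carrier (monomial_group n) \<noteq> ({} :: 'a mat set)" by blast
  next
    fix g :: "'a mat" assume "g \<in> carrier (monomial_group n)"
    then obtain \<sigma> d where \<sigma>: "\<sigma> permutes {0..<n}" and d: "\<forall>j<n. d j \<noteq> 0" and g: "g = mono_mat n \<sigma> d"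
      unfolding monomial_group_carrier by blast
    let ?s = "inv_into UNIV \<sigma>"
    let ?B = "mono_mat n ?s (\<lambda>j. inverse (d (?s j)))"
    have s: "?s permutes {0..<n}" by (rule permutes_inv[OF \<sigma>])
    have lt: "?s j < n" if "j < n" for j using permutes_in_image[OF s, of j] that by simp
    have "?B * g = mono_mat n id (\<lambda>_. 1)"
      unfolding g mono_mat_mult[OF \<sigma>] permutes_inv_o(2)[OF \<sigma>]
      by (rule mono_mat_cong) (use d in \<open>auto simp: permutes_inverses[OF \<sigma>]\<close>)
    then have "?B \<otimes>\<^bsub>GL n\<^esub> g = \<one>\<^bsub>GL n\<^esub>" by (simp add: mono_mat_one)
    then have "inv\<^bsub>GL n\<^esub> g = ?B"
      by (rule G.inv_equality) (use \<sigma> d s lt in \<open>auto simp: g intro!: mono_mat_in_GL\<close>)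
    then show "inv\<^bsub>GL n\<^esub> g \<in> carrier (monomial_group n)"
      using s d lt by (auto intro: mono_mat_in_monomial_group)
  next
    fix g h :: "'a mat"
    assume "g \<in> carrier (monomial_group n)" "h \<in> carrier (monomial_group n)"
    then obtain \<sigma> d \<tau> e where g: "\<sigma> permutes {0..<n}" "\<forall>j<n. d j \<noteq> 0" "g = mono_mat n \<sigma> d"
      and h: "\<tau> permutes {0..<n}" "\<forall>j<n. e j \<noteq> 0" "h = mono_mat n \<tau> e"
      unfolding monomial_group_carrier by blast
    have lt: "\<tau> j < n" if "j < n" for j using permutes_in_image[OF h(1), of j] that by simp
    have "g \<otimes>\<^bsub>GL n\<^esub> h = mono_mat n (\<sigma> \<circ> \<tau>) (\<lambda>j. d (\<tau> j) * e j)"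
      by (simp add: g(3) h(3) mono_mat_mult[OF h(1)])
    moreover have "\<sigma> \<circ> \<tau> permutes {0..<n}" by (rule permutes_compose[OF h(1) g(1)])
    ultimately show "g \<otimes>\<^bsub>GL n\<^esub> h \<in> carrier (monomial_group n)"
      using g(2) h(2) lt by (auto intro: mono_mat_in_monomial_group)
  qed
qed

lemma monomial_group_group: "group (monomial_group n :: 'a::field mat monoid)"
proof -
  interpret G: group "GL n :: 'a mat monoid" by (rule group_GL)
  have "monomial_group n = (GL n :: 'a mat monoid)\<lparr>carrier := carrier (monomial_group n)\<rparr>"
    by (simp add: monomial_group_def)
  then show ?thesis using G.subgroup_imp_group[OF monomial_subgroup[where 'a = 'a]] by metis
qed

lemma mult_monomial_group [simp]: "monoid.mult (monomial_group n) = (*)"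
  and one_monomial_group [simp]: "monoid.one (monomial_group n) = 1\<^sub>m n"
  by (simp_all add: monomial_group_def)

lemma perm_mat_in_monomial_group:
  "\<sigma> permutes {0..<n} \<Longrightarrow> perm_mat n \<sigma> \<in> carrier (monomial_group n)"
  unfolding perm_mat_eq_mono_mat by (rule mono_mat_in_monomial_group) auto

section \<open>The action on structure matrices\<close>

text \<open>For a monomial matrix \<open>\<sigma> t\<close> this is \<open>\<sigma> t\<^sup>2\<close>. On all matrices squaring entries is not
  multiplicative, but it is on monomial ones, where every entry of a product is a single product.\<close>

abbreviation square_entries :: "'a::field mat \<Rightarrow> 'a mat" where
  "square_entries \<equiv> map_mat (\<lambda>x. x * x)"

lemma square_entries_mono_mat: "square_entries (mono_mat n \<sigma> d) = mono_mat n \<sigma> (\<lambda>j. d j * d j)"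
  by (rule eq_matI) (auto simp: mono_mat_def)

lemma square_entries_mult:
  assumes "g \<in> carrier (monomial_group n)" "h \<in> carrier (monomial_group n)"
  shows "square_entries (g * h) = square_entries g * square_entries h"
proof -
  obtain \<sigma> d \<tau> e where "g = mono_mat n \<sigma> d" "\<tau> permutes {0..<n}" "h = mono_mat n \<tau> e"
    using assms unfolding monomial_group_carrier by blast
  then show ?thesis
    by (simp add: mono_mat_mult square_entries_mono_mat mult.commute mult.left_commute)
qed

lemma square_entries_in_GL:
  "g \<in> carrier (monomial_group n) \<Longrightarrow> square_entries g \<in> carrier (GL n)"
  unfolding monomial_group_carrier
  by (auto simp: square_entries_mono_mat intro!: mono_mat_in_GL)

text \<open>This form of the action no longer mentions the decomposition of \<open>g\<close>; in it the
  action law is immediate from the multiplicativity of \<open>square_entries\<close>.\<close>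

lemma monomial_act_eq_squares:
  fixes g :: "'a::field mat"
  assumes g: "g \<in> carrier (monomial_group n)" and A: "A \<in> carrier_mat n n"
  shows "monomial_act n g A = inv\<^bsub>GL n\<^esub> g * A * square_entries g"
proof -
  interpret G: group "GL n :: 'a mat monoid" by (rule group_GL)
  obtain \<sigma> d where \<sigma>: "\<sigma> permutes {0..<n}" and d: "\<forall>j<n. d j \<noteq> 0" and gd: "g = mono_mat n \<sigma> d"
    using g unfolding monomial_group_carrier by blast
  let ?P = "perm_mat n \<sigma> :: 'a mat" and ?t = "mono_mat n id d"
  have t: "?t \<in> diag_subgroup n" using d unfolding diag_subgroup_eq by blast
  have P: "?P \<in> carrier (GL n)" by (rule perm_mat_in_GL[OF \<sigma>])
  have tG: "?t \<in> carrier (GL n)" using t by (simp add: diag_subgroup_def)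
  have c: "inv\<^bsub>GL n\<^esub> ?t \<in> carrier_mat n n" "inv\<^bsub>GL n\<^esub> ?P \<in> carrier_mat n n" "?P \<in> carrier_mat n n"
    using P tG by (auto intro: GL_carrier_mat)
  have g_eq: "g = ?P * ?t" by (simp add: gd perm_mat_mult_diag)
  have inv: "inv\<^bsub>GL n\<^esub> g = inv\<^bsub>GL n\<^esub> ?t * inv\<^bsub>GL n\<^esub> ?P"
    using G.inv_mult_group[OF P tG] by (simp add: g_eq)
  have sq: "?P * (?t * ?t) = square_entries g"
    unfolding gd square_entries_mono_mat mono_mat_mult[OF permutes_id] by (simp add: perm_mat_mult_diag)
  have "monomial_act n g A = inv\<^bsub>GL n\<^esub> ?t * inv\<^bsub>GL n\<^esub> ?P * A * ?P * (?t * ?t)"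
    unfolding g_eq by (rule monomial_act_eq[OF \<sigma> t])
  also have "\<dots> = inv\<^bsub>GL n\<^esub> ?t * inv\<^bsub>GL n\<^esub> ?P * A * (?P * (?t * ?t))"
    using c A by (intro assoc_mult_mat[of _ n n _ n _ n] mult_carrier_mat[of _ n n] mono_mat_carrier) auto
  finally show ?thesis unfolding sq inv .
qed

lemma GL_mult_closed: "A \<in> carrier (GL n) \<Longrightarrow> B \<in> carrier (GL n) \<Longrightarrow> A * B \<in> carrier (GL n)"
  using monoid.m_closed[OF group.is_monoid[OF group_GL], of A n B] by simp

lemma monomial_act_closed:
  assumes "g \<in> carrier (monomial_group n)" "A \<in> carrier (GL n)"
  shows "monomial_act n g A \<in> carrier (GL n)"
  unfolding monomial_act_eq_squares[OF assms(1) GL_carrier_mat[OF assms(2)]]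
  using assms monomial_subgroup[of n]
  by (auto intro!: GL_mult_closed group.inv_closed[OF group_GL] square_entries_in_GL
      dest: subgroup.mem_carrier)

lemma monomial_act_mult:
  fixes g :: "'a::field mat"
  assumes g: "g \<in> carrier (monomial_group n)" and h: "h \<in> carrier (monomial_group n)"
    and A: "A \<in> carrier (GL n)"
  shows "monomial_act n (g * h) A = monomial_act n h (monomial_act n g A)"
proof -
  interpret G: group "GL n :: 'a mat monoid" by (rule group_GL)
  interpret M: group "monomial_group n :: 'a mat monoid" by (rule monomial_group_group)
  have gG: "g \<in> carrier (GL n)" and hG: "h \<in> carrier (GL n)"
    using g h monomial_subgroup[of n] by (auto dest: subgroup.mem_carrier)
  have gh: "g * h \<in> carrier (monomial_group n)" using M.m_closed[OF g h] by simp
  let ?g = "inv\<^bsub>GL n\<^esub> g" and ?h = "inv\<^bsub>GL n\<^esub> h" and ?sg = "square_entries g" and ?sh = "square_entries h"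
  have c: "?g \<in> carrier_mat n n" "?h \<in> carrier_mat n n" "?sg \<in> carrier_mat n n" "?sh \<in> carrier_mat n n"
    "A \<in> carrier_mat n n"
    using gG hG A square_entries_in_GL[OF g] square_entries_in_GL[OF h] by (auto intro: GL_carrier_mat)
  have "inv\<^bsub>GL n\<^esub> (g * h) = ?h * ?g" using G.inv_mult_group[OF gG hG] by simp
  then have "monomial_act n (g * h) A = (?h * ?g) * A * (?sg * ?sh)"
    using monomial_act_eq_squares[OF gh c(5)] square_entries_mult[OF g h] by simp
  also have "\<dots> = ?h * (?g * A * ?sg) * ?sh"
    using c by (simp add: assoc_mult_mat[of _ n n _ n _ n])
  also have "\<dots> = monomial_act n h (monomial_act n g A)"
    using monomial_act_eq_squares[OF g c(5)]
      monomial_act_eq_squares[OF h GL_carrier_mat[OF monomial_act_closed[OF g A]]] by simp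
  finally show ?thesis .
qed

lemma monomial_act_one:
  assumes "A \<in> carrier (GL n)"
  shows "monomial_act n (1\<^sub>m n) A = (A :: 'a::field mat)"
proof -
  interpret G: group "GL n :: 'a mat monoid" by (rule group_GL)
  interpret M: group "monomial_group n :: 'a mat monoid" by (rule monomial_group_group)
  have "square_entries (1\<^sub>m n) = (1\<^sub>m n :: 'a mat)" by (rule eq_matI) auto
  moreover have "inv\<^bsub>GL n\<^esub> (1\<^sub>m n) = (1\<^sub>m n :: 'a mat)" using G.inv_one by simp
  ultimately show ?thesis
    using monomial_act_eq_squares[of "1\<^sub>m n" n A] M.one_closed GL_carrier_mat[OF assms] by simp
qed

text \<open>Inverting the group element turns the right action into a left action with the same orbits,
  to which Burnside's lemma applies.\<close>

lemma monomial_group_action: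
  "group_action (monomial_group n :: 'a::field mat monoid) (carrier (GL n))
     (\<lambda>g. \<lambda>A\<in>carrier (GL n). monomial_act n (inv\<^bsub>monomial_group n\<^esub> g) A)"
proof -
  interpret M: group "monomial_group n :: 'a mat monoid" by (rule monomial_group_group)
  let ?X = "carrier (GL n) :: 'a mat set"
  let ?\<phi> = "\<lambda>g. \<lambda>A\<in>?X. monomial_act n (inv\<^bsub>monomial_group n\<^esub> g) A"
  have bij: "?\<phi> g \<in> Bij ?X" if g: "g \<in> carrier (monomial_group n)" for g
  proof -
    let ?i = "inv\<^bsub>monomial_group n\<^esub> g"
    have i: "?i \<in> carrier (monomial_group n)" using g by (rule M.inv_closed)
    have "bij_betw (monomial_act n ?i) ?X ?X"
    proof (rule bij_betw_byWitness[where f' = "monomial_act n g"])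
      show "\<forall>A\<in>?X. monomial_act n g (monomial_act n ?i A) = A"
        using monomial_act_mult[OF i g, symmetric] M.l_inv[OF g] by (simp add: monomial_act_one)
      show "\<forall>A\<in>?X. monomial_act n ?i (monomial_act n g A) = A"
        using monomial_act_mult[OF g i, symmetric] M.r_inv[OF g] by (simp add: monomial_act_one)
    qed (use g i in \<open>auto intro: monomial_act_closed\<close>)
    then show ?thesis unfolding Bij_def by (simp add: bij_betw_restrict_eq)
  qed
  have "?\<phi> (g * h) = compose ?X (?\<phi> g) (?\<phi> h)"
    if g: "g \<in> carrier (monomial_group n)" and h: "h \<in> carrier (monomial_group n)" for g h
  proof -
    have inv: "inv\<^bsub>monomial_group n\<^esub> (g * h) = inv\<^bsub>monomial_group n\<^esub> h * inv\<^bsub>monomial_group n\<^esub> g"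
      using M.inv_mult_group[OF g h] by simp
    show ?thesis
      unfolding inv compose_def
      by (rule restrict_ext)
        (simp add: monomial_act_mult monomial_act_closed M.inv_closed g h)
  qed
  then have "?\<phi> \<in> hom (monomial_group n) (BijGroup ?X)"
    using bij by (intro homI) (auto simp: BijGroup_def)
  then have "group_hom (monomial_group n) (BijGroup ?X) ?\<phi>"
    unfolding group_hom_def group_hom_axioms_def using M.is_group group_BijGroup by blast
  then show ?thesis by (simp add: group_action_def)
qed

section \<open>Burnside's lemma for the monomial group\<close>

lemma finite_carrier_mat: "finite (carrier_mat m n :: 'a::finite mat set)"
proof -
  have "A \<in> mat m n ` (({0..<m} \<times> {0..<n}) \<rightarrow>\<^sub>E UNIV)" if "A \<in> carrier_mat m n" for A :: "'a mat"
  proof (rule image_eqI)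
    show "A = mat m n (restrict (($$) A) ({0..<m} \<times> {0..<n}))"
      by (rule eq_matI) (use that in auto)
  qed auto
  then have "carrier_mat m n \<subseteq> mat m n ` (({0..<m} \<times> {0..<n}) \<rightarrow>\<^sub>E (UNIV :: 'a set))" by blast
  moreover have "finite (({0..<m} \<times> {0..<n}) \<rightarrow>\<^sub>E (UNIV :: 'a set))" by (intro finite_PiE) auto
  ultimately show ?thesis by (rule finite_subset[OF _ finite_imageI])
qed

lemma finite_GL: "finite (carrier (GL n) :: 'a::{field,finite} mat set)"
  by (rule finite_subset[OF _ finite_carrier_mat[of n n]]) (auto intro: GL_carrier_mat)

lemma card_diag_subgroup:
  "card (diag_subgroup n :: 'a::{field,finite} mat set) = (CARD('a) - 1) ^ n"
proof -
  let ?D = "{0..<n} \<rightarrow>\<^sub>E (UNIV - {0 :: 'a})"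
  have "bij_betw (mono_mat n id) ?D (diag_subgroup n)"
    unfolding bij_betw_def
  proof
    show "inj_on (mono_mat n id) ?D"
    proof (rule inj_onI)
      fix d e assume de: "d \<in> ?D" "e \<in> ?D" and eq: "mono_mat n id d = (mono_mat n id e :: 'a mat)"
      have "d j = e j" if "j \<in> {0..<n}" for j
        using arg_cong[OF eq, of "\<lambda>A. A $$ (j, j)"] that by (simp add: mono_mat_def)
      then show "d = e" by (rule PiE_ext[OF de])
    qed
    show "mono_mat n id ` ?D = diag_subgroup n"
      unfolding diag_subgroup_eq
    proof (intro Set.equalityI subsetI)
      fix t assume "t \<in> {mono_mat n id d | d :: nat \<Rightarrow> 'a. \<forall>j<n. d j \<noteq> 0}"
      then obtain d :: "nat \<Rightarrow> 'a" where d: "t = mono_mat n id d" "\<forall>j<n. d j \<noteq> 0" by blast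
      have "t = mono_mat n id (restrict d {0..<n})" unfolding d(1) by (rule mono_mat_cong) auto
      moreover have "restrict d {0..<n} \<in> ?D" using d(2) by auto
      ultimately show "t \<in> mono_mat n id ` ?D" by blast
    qed (auto simp: PiE_iff)
  qed
  then have "card (diag_subgroup n :: 'a mat set) = card ?D" by (simp add: bij_betw_same_card)
  also have "\<dots> = (CARD('a) - 1) ^ n" by (simp add: card_PiE card_Diff_singleton)
  finally show ?thesis .
qed

lemma bij_betw_monomial_group:
  "bij_betw (\<lambda>(\<sigma>, t). perm_mat n \<sigma> * t) ({\<sigma>. \<sigma> permutes {0..<n}} \<times> diag_subgroup n)
     (carrier (monomial_group n) :: 'a::field mat set)"
  unfolding bij_betw_def
proof
  show "inj_on (\<lambda>(\<sigma>, t). perm_mat n \<sigma> * t :: 'a mat) ({\<sigma>. \<sigma> permutes {0..<n}} \<times> diag_subgroup n)"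
    by (rule inj_onI) (auto dest: monomial_decomp_unique)
qed (auto simp: monomial_group_def)

text \<open>Translation by \<open>x\<inverse>\<close> carries the fixed points of \<open>g\<close> to those of \<open>x g x\<inverse>\<close>.\<close>

lemma card_invariants_conj:
  fixes g x :: "'a::field mat"
  assumes g: "g \<in> carrier (monomial_group n)" and x: "x \<in> carrier (monomial_group n)"
  shows "card (invariants (carrier (GL n)) (monomial_act n) (x * g * inv\<^bsub>monomial_group n\<^esub> x)) =
    card (invariants (carrier (GL n)) (monomial_act n) g)"
proof -
  interpret M: group "monomial_group n :: 'a mat monoid" by (rule monomial_group_group)
  let ?X = "carrier (GL n) :: 'a mat set" and ?a = "monomial_act n :: 'a mat \<Rightarrow> _"
  let ?y = "inv\<^bsub>monomial_group n\<^esub> x"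
  have y: "?y \<in> carrier (monomial_group n)" using x by (rule M.inv_closed)
  have xg: "x * g \<in> carrier (monomial_group n)" using M.m_closed[OF x g] by simp
  have act: "?a (x * g * ?y) A = ?a ?y (?a g (?a x A))" if "A \<in> ?X" for A
    using that xg g x y by (simp add: monomial_act_mult monomial_act_closed)
  have xy: "?a x (?a ?y A) = A" "?a ?y (?a x A) = A" if "A \<in> ?X" for A
    using monomial_act_mult[OF y x that] monomial_act_mult[OF x y that] M.l_inv[OF x] M.r_inv[OF x]
      monomial_act_one[OF that] by simp_all
  have "bij_betw (?a ?y) (invariants ?X ?a g) (invariants ?X ?a (x * g * ?y))"
  proof (rule bij_betw_byWitness[where f' = "?a x"])
    show "?a ?y ` invariants ?X ?a g \<subseteq> invariants ?X ?a (x * g * ?y)"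
      by (auto simp: invariants_def act xy monomial_act_closed y)
    show "?a x ` invariants ?X ?a (x * g * ?y) \<subseteq> invariants ?X ?a g"
    proof
      fix B assume "B \<in> ?a x ` invariants ?X ?a (x * g * ?y)"
      then obtain A where A: "A \<in> ?X" "?a ?y (?a g (?a x A)) = A" and B: "B = ?a x A"
        by (auto simp: invariants_def act)
      have "?a x (?a ?y (?a g (?a x A))) = ?a g (?a x A)"
        by (rule xy) (simp add: monomial_act_closed g x A(1))
      then show "B \<in> invariants ?X ?a g"
        using A B by (simp add: invariants_def monomial_act_closed x)
    qed
  qed (auto simp: invariants_def xy)
  then show ?thesis by (simp add: bij_betw_same_card)
qed

text \<open>Conjugation by the permutation matrix of \<open>\<tau>\<close> permutes the diagonal entries of \<open>t\<close>,
  hence it maps the coset of \<open>\<sigma>\<close> bijectively to that of \<open>\<tau> \<sigma> \<tau>\<inverse>\<close>.\<close>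

lemma sum_invariants_conj:
  assumes \<sigma>: "\<sigma> permutes {0..<n}" and \<tau>: "\<tau> permutes {0..<n}"
  defines "F \<equiv> \<lambda>g :: 'a::field mat. real (card (invariants (carrier (GL n)) (monomial_act n) g))"
  shows "(\<Sum>t\<in>diag_subgroup n. F (perm_mat n (\<tau> \<circ> \<sigma> \<circ> inv_into UNIV \<tau>) * t)) =
    (\<Sum>t\<in>diag_subgroup n. F (perm_mat n \<sigma> * t))"
proof -
  let ?i = "inv_into UNIV \<tau>"
  have i: "?i permutes {0..<n}" by (rule permutes_inv[OF \<tau>])
  have lt: "\<tau> j < n" "?i j < n" if "j < n" for j
    using permutes_in_image[OF \<tau>, of j] permutes_in_image[OF i, of j] that by auto
  interpret M: group "monomial_group n :: 'a mat monoid" by (rule monomial_group_group)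
  let ?P = "perm_mat n :: _ \<Rightarrow> 'a mat"
  have inv: "inv\<^bsub>monomial_group n\<^esub> ?P \<tau> = ?P ?i"
  proof -
    have "?P ?i * ?P \<tau> = 1\<^sub>m n"
      unfolding perm_mat_eq_mono_mat mono_mat_mult[OF \<tau>] permutes_inv_o(2)[OF \<tau>]
      by (simp add: mono_mat_one)
    then show ?thesis
      by (intro M.inv_equality) (auto intro: perm_mat_in_monomial_group i \<tau>)
  qed
  have conj: "?P \<tau> * (?P \<sigma> * mono_mat n id d) * ?P ?i =
      ?P (\<tau> \<circ> \<sigma> \<circ> ?i) * mono_mat n id (\<lambda>j. d (?i j))" for d :: "nat \<Rightarrow> 'a"
    unfolding perm_mat_mult_diag unfolding perm_mat_eq_mono_mat mono_mat_mult[OF \<sigma>] mono_mat_mult[OF i]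
    by simp
  let ?c = "\<lambda>\<rho> t. mono_mat n id (\<lambda>j. t $$ (\<rho> j, \<rho> j)) :: 'a mat"
  have c_mono: "?c \<rho> (mono_mat n id d) = mono_mat n id (\<lambda>j. d (\<rho> j))"
    if "\<rho> permutes {0..<n}" for \<rho> and d :: "nat \<Rightarrow> 'a"
    using permutes_in_image[OF that] by (intro mono_mat_cong) (auto simp: mono_mat_def)
  show ?thesis
  proof (rule sum.reindex_bij_witness[where i = "?c ?i" and j = "?c \<tau>"])
    fix t assume "t \<in> (diag_subgroup n :: 'a mat set)"
    then obtain d where d: "t = mono_mat n id d" "\<forall>j<n. d j \<noteq> 0" unfolding diag_subgroup_eq by blast
    show "?c ?i (?c \<tau> t) = t" "?c \<tau> (?c ?i t) = t"
      unfolding d(1) c_mono[OF i] c_mono[OF \<tau>] permutes_inverses[OF \<tau>] by (rule refl)+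
    show "?c \<tau> t \<in> diag_subgroup n" "?c ?i t \<in> diag_subgroup n"
      unfolding d(1) c_mono[OF i] c_mono[OF \<tau>] diag_subgroup_eq using d(2) lt by blast+
    have "?P \<sigma> * ?c \<tau> t \<in> carrier (monomial_group n)"
      unfolding d(1) c_mono[OF \<tau>] perm_mat_mult_diag monomial_group_carrier using \<sigma> d(2) lt by blast
    from card_invariants_conj[OF this perm_mat_in_monomial_group[OF \<tau>]]
    show "F (?P \<sigma> * ?c \<tau> t) = F (?P (\<tau> \<circ> \<sigma> \<circ> ?i) * t)"
      unfolding F_def inv d(1) c_mono[OF \<tau>] conj permutes_inverses[OF \<tau>] by simp
  qed
qed

lemma orbits_eq_orbits_inv:
  "orbits (monomial_group n :: 'a::field mat monoid) (carrier (GL n)) (monomial_act n) =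
   orbits (monomial_group n) (carrier (GL n))
     (\<lambda>g. \<lambda>A\<in>carrier (GL n). monomial_act n (inv\<^bsub>monomial_group n\<^esub> g) A)"
proof -
  interpret M: group "monomial_group n :: 'a mat monoid" by (rule monomial_group_group)
  let ?\<phi> = "\<lambda>g. \<lambda>A\<in>carrier (GL n) :: 'a mat set. monomial_act n (inv\<^bsub>monomial_group n\<^esub> g) A"
  have "orbit (monomial_group n) (monomial_act n) A = orbit (monomial_group n) ?\<phi> A"
    if A: "A \<in> carrier (GL n)" for A :: "'a mat"
    unfolding orbit_def using A
    by (auto intro: M.inv_closed) (metis M.inv_closed M.inv_inv)
  then show ?thesis unfolding orbits_def by (metis (no_types, lifting))
qed

lemma burnside_monomial:
  "card (orbits (monomial_group n :: 'a::{field,finite} mat monoid) (carrier (GL n)) (monomial_act n))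
     * (fact n * (CARD('a) - 1) ^ n) =
   (\<Sum>\<sigma> | \<sigma> permutes {0..<n}. \<Sum>t\<in>diag_subgroup n.
     card (invariants (carrier (GL n)) (monomial_act n) (perm_mat n \<sigma> * t :: 'a mat)))"
proof -
  interpret M: group "monomial_group n :: 'a mat monoid" by (rule monomial_group_group)
  let ?G = "monomial_group n :: 'a mat monoid" and ?X = "carrier (GL n) :: 'a mat set"
  let ?\<phi> = "\<lambda>g. \<lambda>A\<in>?X. monomial_act n (inv\<^bsub>monomial_group n\<^esub> g) A"
  let ?F = "\<lambda>g. card (invariants ?X (monomial_act n) g)"
  let ?S = "{\<sigma>. \<sigma> permutes {0..<n}}" and ?T = "diag_subgroup n :: 'a mat set"
  interpret A: group_action ?G ?X ?\<phi> by (rule monomial_group_action)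
  have fin: "finite (carrier ?G)"
    by (rule finite_subset[OF subgroup.subset[OF monomial_subgroup] finite_GL])
  have order: "Coset.order ?G = fact n * (CARD('a) - 1) ^ n"
  proof -
    have "Coset.order ?G = card (?S \<times> ?T)"
      unfolding Coset.order_def using bij_betw_same_card[OF bij_betw_monomial_group] by metis
    then show ?thesis
      using card_permutations[of "{0..<n}" n] by (simp add: card_cartesian_product card_diag_subgroup)
  qed
  have "card (orbits ?G ?X (monomial_act n)) * Coset.order ?G = (\<Sum>g\<in>carrier ?G. card (invariants ?X ?\<phi> g))"
    unfolding orbits_eq_orbits_inv by (rule A.burnside[OF fin finite_GL])
  also have "\<dots> = (\<Sum>g\<in>carrier ?G. ?F (inv\<^bsub>?G\<^esub> g))"
    by (intro sum.cong refl arg_cong[of _ _ card]) (auto simp: invariants_def)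
  also have "\<dots> = (\<Sum>g\<in>carrier ?G. ?F g)"
    by (rule sum.reindex_bij_witness[where i = "m_inv ?G" and j = "m_inv ?G"]) auto
  also have "\<dots> = (\<Sum>(\<sigma>, t)\<in>?S \<times> ?T. ?F (perm_mat n \<sigma> * t))"
    using sum.reindex_bij_betw[OF bij_betw_monomial_group, of ?F n, symmetric]
    by (simp add: case_prod_unfold)
  also have "\<dots> = (\<Sum>\<sigma>\<in>?S. \<Sum>t\<in>?T. ?F (perm_mat n \<sigma> * t))"
    by (rule sum.cartesian_product[symmetric])
  finally show ?thesis unfolding order .
qed

section \<open>Linear maps out of coordinate space\<close>

text \<open>A property of vectors that is closed under addition need only be checked on multiples of unit
  vectors. Two such inductions replace the double sums of a bilinear computation.\<close>

lemma carrier_vec_induct [consumes 1, case_names zero unit add]: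
  fixes P :: "'a::field vec \<Rightarrow> bool"
  assumes v: "v \<in> carrier_vec n"
    and zero: "P (0\<^sub>v n)"
    and unit: "\<And>i c. i < n \<Longrightarrow> P (c \<cdot>\<^sub>v unit_vec n i)"
    and add: "\<And>x y. x \<in> carrier_vec n \<Longrightarrow> y \<in> carrier_vec n \<Longrightarrow> P x \<Longrightarrow> P y \<Longrightarrow> P (x + y)"
  shows "P v"
proof -
  have "P (vec n (\<lambda>i. if i < k then v $ i else 0))" if "k \<le> n" for k
    using that
  proof (induction k)
    case 0
    have "vec n (\<lambda>i. if i < 0 then v $ i else 0) = 0\<^sub>v n" by (rule eq_vecI) auto
    then show ?case using zero by simp
  next
    case (Suc k)
    have "vec n (\<lambda>i. if i < Suc k then v $ i else 0) =
        vec n (\<lambda>i. if i < k then v $ i else 0) + (v $ k) \<cdot>\<^sub>v unit_vec n k"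
      using Suc.prems by (intro eq_vecI) (auto simp: less_Suc_eq)
    then show ?case using Suc add unit by simp
  qed
  moreover have "vec n (\<lambda>i. if i < n then v $ i else 0) = v" using v by (intro eq_vecI) auto
  ultimately show ?thesis by (metis order_refl)
qed

definition lin_maps :: "nat \<Rightarrow> ('a::field, 'v) module \<Rightarrow> ('a vec \<Rightarrow> 'v) set" where
  "lin_maps n E = LinearCombinations.module_hom class_ring (module_vec TYPE('a) n) E"

lemma lin_maps_iff:
  "f \<in> lin_maps n E \<longleftrightarrow>
     (\<forall>x \<in> carrier_vec n. f x \<in> carrier E) \<and>
     (\<forall>x \<in> carrier_vec n. \<forall>y \<in> carrier_vec n. f (x + y) = f x \<oplus>\<^bsub>E\<^esub> f y) \<and>
     (\<forall>c. \<forall>x \<in> carrier_vec n. f (c \<cdot>\<^sub>v x) = c \<odot>\<^bsub>E\<^esub> f x)"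
  unfolding lin_maps_def LinearCombinations.module_hom_def by (auto simp: module_vec_simps)

context vectorspace
begin

text \<open>A function \<open>e\<close> on the indices below \<open>n\<close> extends to the linear map that sends the \<open>i\<close>-th unit
  vector to \<open>e i\<close>.\<close>

definition coord_map :: "nat \<Rightarrow> (nat \<Rightarrow> 'c) \<Rightarrow> 'a vec \<Rightarrow> 'c" where
  "coord_map n e v = (\<Oplus>\<^bsub>V\<^esub>i\<in>{0..<n}. v $ i \<odot>\<^bsub>V\<^esub> e i)"

end

lemma coord_map_linear:
  fixes E :: "('a::field, 'v) module"
  assumes E: "vectorspace class_ring E" and e: "e \<in> {0..<n} \<rightarrow> carrier E"
  shows "vectorspace.coord_map E n e \<in> lin_maps n E"
proof -
  interpret vectorspace class_ring E by (rule E)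
  have e': "e i \<in> carrier E" if "i < n" for i using e that by auto
  have cl: "(\<lambda>i. c i \<odot>\<^bsub>E\<^esub> e i) \<in> {0..<n} \<rightarrow> carrier E" for c :: "nat \<Rightarrow> 'a"
    using e' by (auto intro!: smult_closed)
  show ?thesis
    unfolding lin_maps_iff
  proof (intro conjI ballI allI)
    fix x :: "'a vec" assume x: "x \<in> carrier_vec n"
    show "coord_map n e x \<in> carrier E" unfolding coord_map_def using cl by (rule finsum_closed)
    show "coord_map n e (c \<cdot>\<^sub>v x) = c \<odot>\<^bsub>E\<^esub> coord_map n e x" for c
    proof -
      have "coord_map n e (c \<cdot>\<^sub>v x) = (\<Oplus>\<^bsub>E\<^esub>i\<in>{0..<n}. c \<odot>\<^bsub>E\<^esub> (x $ i \<odot>\<^bsub>E\<^esub> e i))"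
        unfolding coord_map_def
        by (rule finsum_cong') (use x e' in \<open>auto simp: smult_assoc1[simplified] intro!: smult_closed\<close>)
      then show ?thesis unfolding coord_map_def using finsum_smult[of c, OF _ cl] by simp
    qed
    fix y :: "'a vec" assume y: "y \<in> carrier_vec n"
    have "coord_map n e (x + y) = (\<Oplus>\<^bsub>E\<^esub>i\<in>{0..<n}. x $ i \<odot>\<^bsub>E\<^esub> e i \<oplus>\<^bsub>E\<^esub> y $ i \<odot>\<^bsub>E\<^esub> e i)"
      unfolding coord_map_def
      by (rule finsum_cong') (use x y e' in \<open>auto simp: smult_l_distr[simplified] intro!: smult_closed\<close>)
    then show "coord_map n e (x + y) = coord_map n e x \<oplus>\<^bsub>E\<^esub> coord_map n e y"
      unfolding coord_map_def using finsum_addf[OF cl cl] by simp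
  qed
qed

lemma coord_map_unit_vec:
  fixes E :: "('a::field, 'v) module"
  assumes E: "vectorspace class_ring E" and e: "e \<in> {0..<n} \<rightarrow> carrier E" and i: "i < n"
  shows "vectorspace.coord_map E n e (unit_vec n i) = e i"
proof -
  interpret vectorspace class_ring E by (rule E)
  have e': "e j \<in> carrier E" if "j < n" for j using e that by auto
  have "coord_map n e (unit_vec n i) = (\<Oplus>\<^bsub>E\<^esub>j\<in>{0..<n}. if i = j then e j else \<zero>\<^bsub>E\<^esub>)"
    unfolding coord_map_def
    by (rule finsum_cong') (use e' i lmult_0 smult_one in \<open>auto simp: unit_vec_def\<close>)
  also have "\<dots> = e i" using i e by (intro finsum_singleton) auto
  finally show ?thesis .
qed

text \<open>A basis is the same as a bijective coordinate map. This criterion, unlike independence and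
  spanning, is visibly preserved by isomorphisms.\<close>

lemma basis_iff_coord_map_bij:
  fixes E :: "('a::field, 'v) module"
  assumes E: "vectorspace class_ring E" and e: "e \<in> {0..<n} \<rightarrow> carrier E" and inj: "inj_on e {0..<n}"
  shows "vectorspace.basis class_ring E (e ` {0..<n}) \<longleftrightarrow>
    bij_betw (vectorspace.coord_map E n e) (carrier_vec n) (carrier E)"
proof -
  interpret vectorspace class_ring E by (rule E)
  let ?B = "e ` {0..<n}" and ?f = "coord_map n e"
  let ?v = "\<lambda>a. vec n (\<lambda>i. a (e i))" and ?a = "\<lambda>v. restrict (\<lambda>b. v $ inv_into {0..<n} e b) ?B"
  have e': "e i \<in> carrier E" if "i < n" for i using e that by auto
  have lc: "lincomb a ?B = ?f (?v a)" for a
  proof -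
    have "lincomb a ?B = (\<Oplus>\<^bsub>E\<^esub>i\<in>{0..<n}. a (e i) \<odot>\<^bsub>E\<^esub> e i)"
      unfolding lincomb_def using e' inj
      by (intro finsum_reindex) (auto intro!: smult_closed)
    also have "\<dots> = ?f (?v a)"
      unfolding coord_map_def by (rule finsum_cong') (use e' in \<open>auto intro!: smult_closed\<close>)
    finally show ?thesis .
  qed
  have av: "?v (?a v) = v" if "v \<in> carrier_vec n" for v
    using that inj by (intro eq_vecI) auto
  have va: "?a (?v a) = a" if "a \<in> ?B \<rightarrow>\<^sub>E UNIV" for a
    using that inj by (intro PiE_ext[of _ ?B "\<lambda>_. UNIV"]) auto
  have aB: "?a v \<in> ?B \<rightarrow>\<^sub>E UNIV" for v by auto
  have cl: "?f v \<in> carrier E" if "v \<in> carrier_vec n" for v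
    using coord_map_linear[OF E e] that by (simp add: lin_maps_iff)
  have "basis ?B \<longleftrightarrow> (\<forall>x. x \<in> carrier E \<longrightarrow> (\<exists>!a. a \<in> ?B \<rightarrow>\<^sub>E UNIV \<and> ?f (?v a) = x))"
  proof -
    have "?B \<subseteq> carrier E" using e' by auto
    from basis_criterion[OF _ this] show ?thesis unfolding lc by simp
  qed
  also have "\<dots> \<longleftrightarrow> (\<forall>x. x \<in> carrier E \<longrightarrow> (\<exists>!v. v \<in> carrier_vec n \<and> ?f v = x))"
  proof (intro iff_allI imp_cong refl)
    fix x
    show "(\<exists>!a. a \<in> ?B \<rightarrow>\<^sub>E UNIV \<and> ?f (?v a) = x) \<longleftrightarrow> (\<exists>!v. v \<in> carrier_vec n \<and> ?f v = x)"
    proof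
      assume "\<exists>!a. a \<in> ?B \<rightarrow>\<^sub>E UNIV \<and> ?f (?v a) = x"
      then obtain a where a: "a \<in> ?B \<rightarrow>\<^sub>E UNIV \<and> ?f (?v a) = x"
        and uniq: "\<forall>b. b \<in> ?B \<rightarrow>\<^sub>E UNIV \<and> ?f (?v b) = x \<longrightarrow> b = a" by (rule ex1E)
      show "\<exists>!v. v \<in> carrier_vec n \<and> ?f v = x"
      proof (rule ex1I[of _ "?v a"])
        fix v assume v: "v \<in> carrier_vec n \<and> ?f v = x"
        then have "?f (?v (?a v)) = x" unfolding av[OF conjunct1[OF v]] by simp
        then have "?a v = a" using uniq aB by metis
        then show "v = ?v a" using av[OF conjunct1[OF v]] by metis
      qed (use a in simp)
    next
      assume "\<exists>!v. v \<in> carrier_vec n \<and> ?f v = x"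
      then obtain v where v: "v \<in> carrier_vec n \<and> ?f v = x"
        and uniq: "\<forall>w. w \<in> carrier_vec n \<and> ?f w = x \<longrightarrow> w = v" by (rule ex1E)
      show "\<exists>!a. a \<in> ?B \<rightarrow>\<^sub>E UNIV \<and> ?f (?v a) = x"
      proof (rule ex1I[of _ "?a v"])
        fix a assume a: "a \<in> ?B \<rightarrow>\<^sub>E UNIV \<and> ?f (?v a) = x"
        then have "?v a = v" using uniq vec_carrier by metis
        then show "a = ?a v" using va[OF conjunct1[OF a]] by metis
      next
        show "?a v \<in> ?B \<rightarrow>\<^sub>E UNIV \<and> ?f (?v (?a v)) = x"
          unfolding av[OF conjunct1[OF v]] using v aB by simp
      qed
    qed
  qed
  also have "\<dots> \<longleftrightarrow> bij_betw ?f (carrier_vec n) (carrier E)"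
  proof
    assume "\<forall>x. x \<in> carrier E \<longrightarrow> (\<exists>!v. v \<in> carrier_vec n \<and> ?f v = x)"
    then show "bij_betw ?f (carrier_vec n) (carrier E)"
      using cl by (intro bij_betwI') metis+
  next
    assume bij: "bij_betw ?f (carrier_vec n) (carrier E)"
    show "\<forall>x. x \<in> carrier E \<longrightarrow> (\<exists>!v. v \<in> carrier_vec n \<and> ?f v = x)"
    proof (intro allI impI)
      fix x assume "x \<in> carrier E"
      then have "x \<in> ?f ` carrier_vec n" using bij by (simp add: bij_betw_def)
      then obtain v where v: "v \<in> carrier_vec n" "?f v = x" by (elim imageE) simp
      show "\<exists>!v. v \<in> carrier_vec n \<and> ?f v = x"
        by (rule ex1I[of _ v]) (use v inj_onD[OF bij_betw_imp_inj_on[OF bij]] in simp_all)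
    qed
  qed
  finally show ?thesis .
qed

lemma lin_maps_closed: "f \<in> lin_maps n E \<Longrightarrow> x \<in> carrier_vec n \<Longrightarrow> f x \<in> carrier E"
  and lin_maps_add: "f \<in> lin_maps n E \<Longrightarrow> x \<in> carrier_vec n \<Longrightarrow> y \<in> carrier_vec n \<Longrightarrow>
    f (x + y) = f x \<oplus>\<^bsub>E\<^esub> f y"
  and lin_maps_smult: "f \<in> lin_maps n E \<Longrightarrow> x \<in> carrier_vec n \<Longrightarrow> f (c \<cdot>\<^sub>v x) = c \<odot>\<^bsub>E\<^esub> f x"
  by (auto simp: lin_maps_iff)

lemma lin_maps_zero:
  fixes E :: "('a::field, 'v) module"
  assumes "vectorspace class_ring E" "f \<in> lin_maps n E"
  shows "f (0\<^sub>v n) = \<zero>\<^bsub>E\<^esub>"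
proof -
  interpret vectorspace class_ring E by fact
  have "0 \<cdot>\<^sub>v 0\<^sub>v n = (0\<^sub>v n :: 'a vec)" by (rule eq_vecI) auto
  then have "f (0\<^sub>v n) = f (0 \<cdot>\<^sub>v 0\<^sub>v n)" by simp
  also have "\<dots> = 0 \<odot>\<^bsub>E\<^esub> f (0\<^sub>v n)" by (rule lin_maps_smult[OF assms(2)]) simp
  also have "\<dots> = \<zero>\<^bsub>E\<^esub>" using lmult_0[OF lin_maps_closed[OF assms(2)]] by simp
  finally show ?thesis .
qed

lemma lin_maps_eqI:
  assumes E: "vectorspace class_ring E" and f: "f \<in> lin_maps n E" and g: "g \<in> lin_maps n E"
    and eq: "\<And>i. i < n \<Longrightarrow> f (unit_vec n i) = g (unit_vec n i)" and v: "v \<in> carrier_vec n"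
  shows "f v = g v"
  using v
proof (induction rule: carrier_vec_induct)
  case zero
  show ?case using lin_maps_zero[OF E f] lin_maps_zero[OF E g] by simp
next
  case (unit i c)
  show ?case using lin_maps_smult[OF f] lin_maps_smult[OF g] eq[OF unit] by simp
next
  case (add x y)
  then show ?case using lin_maps_add[OF f] lin_maps_add[OF g] by simp
qed

section \<open>The algebra with a given structure matrix\<close>

abbreviation vec_prod :: "nat \<Rightarrow> 'a::field vec \<Rightarrow> 'a vec \<Rightarrow> 'a vec" where
  "vec_prod n x y \<equiv> vec n (\<lambda>i. x $ i * y $ i)"

text \<open>The evolution algebra on coordinate space whose natural basis consists of the unit vectors
  and whose structure matrix is \<open>A\<close>: the entrywise product of \<open>x\<close> and \<open>y\<close> collects the coefficients
  of the squares of the basis vectors, and \<open>A\<close> expresses these squares in the basis.\<close>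

definition structure_algebra :: "nat \<Rightarrow> 'a::field mat \<Rightarrow> ('a, 'a vec) module" where
  "structure_algebra n A = (module_vec TYPE('a) n)\<lparr>monoid.mult := \<lambda>x y. A *\<^sub>v vec_prod n x y\<rparr>"

lemma structure_algebra_simps [simp]:
  "carrier (structure_algebra n A) = carrier_vec n"
  "x \<otimes>\<^bsub>structure_algebra n A\<^esub> y = A *\<^sub>v vec_prod n x y"
  "\<zero>\<^bsub>structure_algebra n A\<^esub> = 0\<^sub>v n"
  "x \<oplus>\<^bsub>structure_algebra n A\<^esub> y = x + y"
  "c \<odot>\<^bsub>structure_algebra n A\<^esub> x = c \<cdot>\<^sub>v x"
  by (simp_all add: structure_algebra_def module_vec_def)

lemma module_hom_structure_algebra:
  "LinearCombinations.module_hom class_ring (structure_algebra n A) E = lin_maps n E"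
  unfolding lin_maps_def LinearCombinations.module_hom_def by (auto simp: module_vec_simps)

lemma vec_prod_add_left: "x \<in> carrier_vec n \<Longrightarrow> y \<in> carrier_vec n \<Longrightarrow>
    vec_prod n (x + y) z = vec_prod n x z + vec_prod n y z"
  and vec_prod_add_right: "x \<in> carrier_vec n \<Longrightarrow> y \<in> carrier_vec n \<Longrightarrow>
    vec_prod n z (x + y) = vec_prod n z x + vec_prod n z y"
  and vec_prod_smult_left: "x \<in> carrier_vec n \<Longrightarrow> vec_prod n (c \<cdot>\<^sub>v x) z = c \<cdot>\<^sub>v vec_prod n x z"
  and vec_prod_smult_right: "x \<in> carrier_vec n \<Longrightarrow> vec_prod n z (c \<cdot>\<^sub>v x) = c \<cdot>\<^sub>v vec_prod n z x"
  and vec_prod_unit: "i < n \<Longrightarrow> j < n \<Longrightarrow>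
    vec_prod n (unit_vec n i) (unit_vec n j) = (if i = j then unit_vec n i else 0\<^sub>v n)"
  by (auto intro!: eq_vecI simp: algebra_simps unit_vec_def)

lemma structure_algebra_nonassoc:
  assumes A: "A \<in> carrier_mat n n"
  shows "nonassoc_algebra (structure_algebra n A :: ('a::field, 'a vec) module)"
proof (intro nonassoc_algebra.intro nonassoc_algebra_axioms.intro)
  have neg: "\<exists>w \<in> carrier_vec n. v + w = 0\<^sub>v n" if "v \<in> carrier_vec n" for v :: "'a vec"
    using that by (intro bexI[of _ "- v"]) auto
  show "vectorspace class_ring (structure_algebra n A)"
  proof (rule vs_criteria[OF class_field])
    show "\<forall>v w. v \<in> carrier (structure_algebra n A) \<and> w \<in> carrier (structure_algebra n A) \<longrightarrow>
        v \<oplus>\<^bsub>structure_algebra n A\<^esub> w = w \<oplus>\<^bsub>structure_algebra n A\<^esub> v"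
      by (auto intro: comm_add_vec)
  qed (use neg in \<open>auto simp: assoc_add_vec[of _ n] smult_smult_assoc add_smult_distrib_vec
        smult_add_distrib_vec[of _ n]\<close>)
qed (use A in \<open>auto simp: vec_prod_add_left vec_prod_add_right vec_prod_smult_left vec_prod_smult_right
    mult_add_distrib_mat_vec[of _ n n] mult_mat_vec[of _ n n]\<close>)

lemma mult_mat_unit_vec:
  assumes "A \<in> carrier_mat n n" "i < n"
  shows "A *\<^sub>v unit_vec n i = (col A i :: 'a::field vec)"
  using assms by (intro eq_vecI) (auto simp: scalar_prod_def unit_vec_def if_distrib cong: if_cong)

lemma mult_mat_vec_lin_maps:
  "P \<in> carrier_mat n n \<Longrightarrow> (\<lambda>v. P *\<^sub>v v) \<in> lin_maps n (structure_algebra n A)"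
  by (auto simp: lin_maps_iff mult_add_distrib_mat_vec[of _ n n] mult_mat_vec[of _ n n])

text \<open>Both sides of a product rule are bilinear, so it suffices to check it on unit vectors.\<close>

lemma product_rule_from_unit_vecs:
  fixes E :: "('a::field, 'v) module"
  assumes E: "nonassoc_algebra E" and f: "f \<in> lin_maps n E" and A: "A \<in> carrier_mat n n"
    and unit: "\<And>i j. i < n \<Longrightarrow> j < n \<Longrightarrow>
      f (unit_vec n i) \<otimes>\<^bsub>E\<^esub> f (unit_vec n j) = (if i = j then f (col A i) else \<zero>\<^bsub>E\<^esub>)"
    and x: "x \<in> carrier_vec n" and y: "y \<in> carrier_vec n"
  shows "f (A *\<^sub>v vec_prod n x y) = f x \<otimes>\<^bsub>E\<^esub> f y"
proof -
  interpret nonassoc_algebra E by (rule E)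
  note vs = nonassoc_algebra.axioms(1)[OF E]
  note f0 = lin_maps_zero[OF vs f] and fc = lin_maps_closed[OF f] and fa = lin_maps_add[OF f]
    and fs = lin_maps_smult[OF f]
  have zl: "\<zero>\<^bsub>E\<^esub> \<otimes>\<^bsub>E\<^esub> z = \<zero>\<^bsub>E\<^esub>" and zr: "z \<otimes>\<^bsub>E\<^esub> \<zero>\<^bsub>E\<^esub> = \<zero>\<^bsub>E\<^esub>" if z: "z \<in> carrier E" for z
    using prod_smult_l[of "\<zero>\<^bsub>E\<^esub>" z 0] prod_smult_r[of z "\<zero>\<^bsub>E\<^esub>" 0] prod_closed z
      lmult_0 by simp_all
  have vz: "vec_prod n (0\<^sub>v n) z = 0\<^sub>v n" "vec_prod n z (0\<^sub>v n) = 0\<^sub>v n" for z by auto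
  have A0: "A *\<^sub>v 0\<^sub>v n = 0\<^sub>v n" using A by auto
  have Ac: "A *\<^sub>v vec_prod n u w \<in> carrier_vec n" for u w using A by auto
  have u: "f (A *\<^sub>v vec_prod n (unit_vec n i) (unit_vec n j)) = f (unit_vec n i) \<otimes>\<^bsub>E\<^esub> f (unit_vec n j)"
    if "i < n" "j < n" for i j
    using that by (simp add: vec_prod_unit unit A0 f0 mult_mat_unit_vec[OF A])
  have l: "f (A *\<^sub>v vec_prod n x (unit_vec n j)) = f x \<otimes>\<^bsub>E\<^esub> f (unit_vec n j)" if j: "j < n" for j
    using x
  proof (induction rule: carrier_vec_induct)
    case zero
    show ?case using j by (simp add: vz A0 f0 zl fc)
  next
    case (unit i c)
    show ?case using u[OF unit j] prod_smult_l
      by (simp add: vec_prod_smult_left mult_mat_vec[OF A] fs fc Ac)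
  next
    case (add v w)
    then show ?case using A prod_l_distr
      by (simp add: vec_prod_add_left mult_add_distrib_mat_vec[OF A] fa fc Ac)
  qed
  show ?thesis
    using y
  proof (induction rule: carrier_vec_induct)
    case zero
    show ?case using x by (simp add: vz A0 f0 zr fc)
  next
    case (unit i c)
    show ?case using l[OF unit] prod_smult_r x
      by (simp add: vec_prod_smult_right mult_mat_vec[OF A] fs fc Ac)
  next
    case (add v w)
    then show ?case using A prod_r_distr x
      by (simp add: vec_prod_add_right mult_add_distrib_mat_vec[OF A] fa fc Ac)
  qed
qed

section \<open>Isomorphisms and structure matrices\<close>

lemma mult_mat_zero_vec: "A \<in> carrier_mat n n \<Longrightarrow> A *\<^sub>v 0\<^sub>v n = (0\<^sub>v n :: 'a::field vec)"
  by (rule eq_vecI) auto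

lemma GL_I_surj:
  fixes A :: "'a::field mat"
  assumes A: "A \<in> carrier_mat n n"
    and surj: "\<And>v. v \<in> carrier_vec n \<Longrightarrow> \<exists>u \<in> carrier_vec n. A *\<^sub>v u = v"
  shows "A \<in> carrier (GL n)"
proof -
  have "\<exists>u. u \<in> carrier_vec n \<and> A *\<^sub>v u = unit_vec n i" for i using surj[of "unit_vec n i"] by auto
  then obtain u where u: "\<And>i. u i \<in> carrier_vec n" "\<And>i. A *\<^sub>v u i = unit_vec n i" by metis
  define B where "B = mat n n (\<lambda>(i, j). u j $ i)"
  have B: "B \<in> carrier_mat n n" by (simp add: B_def)
  have colB: "col B j = u j" if "j < n" for j using that u(1)[of j] by (intro eq_vecI) (auto simp: B_def)
  have AB: "A * B = 1\<^sub>m n"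
  proof (rule eq_matI)
    fix i j assume "i < dim_row (1\<^sub>m n :: 'a mat)" "j < dim_col (1\<^sub>m n :: 'a mat)"
    then have ij: "i < n" "j < n" by auto
    have "(A * B) $$ (i, j) = (A *\<^sub>v col B j) $ i" using ij A B by simp
    then show "(A * B) $$ (i, j) = 1\<^sub>m n $$ (i, j)" using ij by (simp add: colB u(2) unit_vec_def)
  qed (use A B in auto)
  then show ?thesis
    using A B mat_mult_left_right_inverse[OF A B AB] unfolding carrier_GL by blast
qed

lemma GL_surj:
  fixes A :: "'a::field mat"
  assumes "A \<in> carrier (GL n)" "v \<in> carrier_vec n"
  shows "\<exists>u \<in> carrier_vec n. A *\<^sub>v u = v"
proof -
  obtain B where B: "A \<in> carrier_mat n n" "B \<in> carrier_mat n n" "A * B = 1\<^sub>m n"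
    using assms(1) unfolding carrier_GL by blast
  have "A *\<^sub>v (B *\<^sub>v v) = v" using assoc_mult_mat_vec[OF B(1,2) assms(2)] B(3) assms(2) by simp
  then show ?thesis using B(2) assms(2) by (intro bexI[of _ "B *\<^sub>v v"]) auto
qed

lemma GL_inj:
  fixes A :: "'a::field mat"
  assumes "A \<in> carrier (GL n)" "u \<in> carrier_vec n" "v \<in> carrier_vec n" "A *\<^sub>v u = A *\<^sub>v v"
  shows "u = v"
proof -
  obtain B where B: "A \<in> carrier_mat n n" "B \<in> carrier_mat n n" "B * A = 1\<^sub>m n"
    using assms(1) unfolding carrier_GL by blast
  have "B *\<^sub>v (A *\<^sub>v w) = w" if "w \<in> carrier_vec n" for w
    using assoc_mult_mat_vec[OF B(2,1) that] B(3) that by simp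
  then show ?thesis using assms(2-) by metis
qed

lemma algebra_iso_structure_algebra_iff:
  "algebra_iso (structure_algebra n A) E \<longleftrightarrow>
     (\<exists>f \<in> lin_maps n E. bij_betw f (carrier_vec n) (carrier E) \<and>
       (\<forall>x \<in> carrier_vec n. \<forall>y \<in> carrier_vec n. f (A *\<^sub>v vec_prod n x y) = f x \<otimes>\<^bsub>E\<^esub> f y))"
  unfolding algebra_iso_def module_hom_structure_algebra by simp

lemma algebra_iso_trans:
  assumes "algebra_iso E F" "algebra_iso F H"
  shows "algebra_iso E H"
proof -
  obtain f where f: "f \<in> LinearCombinations.module_hom class_ring E F" "bij_betw f (carrier E) (carrier F)"
    "\<forall>x \<in> carrier E. \<forall>y \<in> carrier E. f (x \<otimes>\<^bsub>E\<^esub> y) = f x \<otimes>\<^bsub>F\<^esub> f y"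
    using assms(1) unfolding algebra_iso_def by blast
  obtain g where g: "g \<in> LinearCombinations.module_hom class_ring F H" "bij_betw g (carrier F) (carrier H)"
    "\<forall>x \<in> carrier F. \<forall>y \<in> carrier F. g (x \<otimes>\<^bsub>F\<^esub> y) = g x \<otimes>\<^bsub>H\<^esub> g y"
    using assms(2) unfolding algebra_iso_def by blast
  have fc: "f x \<in> carrier F" if "x \<in> carrier E" for x using f(2) that by (rule bij_betwE[rule_format])
  have "g \<circ> f \<in> LinearCombinations.module_hom class_ring E H"
    using f(1) g(1) fc unfolding LinearCombinations.module_hom_def by (auto simp: Pi_iff)
  moreover have "\<forall>x \<in> carrier E. \<forall>y \<in> carrier E. (g \<circ> f) (x \<otimes>\<^bsub>E\<^esub> y) = (g \<circ> f) x \<otimes>\<^bsub>H\<^esub> (g \<circ> f) y"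
    using f(3) g(3) fc by simp
  ultimately show ?thesis
    unfolding algebra_iso_def using bij_betw_trans[OF f(2) g(2)] by blast
qed

text \<open>Closure of \<open>E\<close> under the operations is what makes the inverse of an isomorphism a
  homomorphism.\<close>

lemma algebra_iso_sym:
  fixes E :: "('a::field, 'v) module"
  assumes E: "nonassoc_algebra E" and iso: "algebra_iso E F"
  shows "algebra_iso F E"
proof -
  interpret nonassoc_algebra E by (rule E)
  obtain f where f: "f \<in> LinearCombinations.module_hom class_ring E F" "bij_betw f (carrier E) (carrier F)"
    "\<forall>x \<in> carrier E. \<forall>y \<in> carrier E. f (x \<otimes>\<^bsub>E\<^esub> y) = f x \<otimes>\<^bsub>F\<^esub> f y"
    using iso unfolding algebra_iso_def by blast
  let ?g = "inv_into (carrier E) f"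
  have gc: "?g y \<in> carrier E" and fg: "f (?g y) = y" if "y \<in> carrier F" for y
    using that f(2) by (auto simp: bij_betw_def inv_into_into f_inv_into_f)
  have gf: "?g (f x) = x" if "x \<in> carrier E" for x
    using that f(2) by (simp add: bij_betw_def)
  have g_eq: "?g y = x" if "x \<in> carrier E" "f x = y" for x y using gf that by blast
  have fa: "f (x \<oplus>\<^bsub>E\<^esub> y) = f x \<oplus>\<^bsub>F\<^esub> f y" if "x \<in> carrier E" "y \<in> carrier E" for x y
    using f(1) that unfolding LinearCombinations.module_hom_def by blast
  have fs: "f (c \<odot>\<^bsub>E\<^esub> x) = c \<odot>\<^bsub>F\<^esub> f x" if "x \<in> carrier E" for c x
    using f(1) that unfolding LinearCombinations.module_hom_def by auto
  have "?g \<in> LinearCombinations.module_hom class_ring F E"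
    unfolding LinearCombinations.module_hom_def
  proof (intro CollectI conjI allI impI)
    show "?g \<in> carrier F \<rightarrow> carrier E" using gc by auto
    show "?g (x \<oplus>\<^bsub>F\<^esub> y) = ?g x \<oplus>\<^bsub>E\<^esub> ?g y" if "x \<in> carrier F \<and> y \<in> carrier F" for x y
      by (rule g_eq) (use that gc fg fa in auto)
    show "?g (c \<odot>\<^bsub>F\<^esub> x) = c \<odot>\<^bsub>E\<^esub> ?g x" if "c \<in> carrier class_ring \<and> x \<in> carrier F" for c x
      by (rule g_eq) (use that gc fg fs in \<open>auto intro!: smult_closed\<close>)
  qed
  moreover have "\<forall>x \<in> carrier F. \<forall>y \<in> carrier F. ?g (x \<otimes>\<^bsub>F\<^esub> y) = ?g x \<otimes>\<^bsub>E\<^esub> ?g y"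
    by (intro ballI g_eq) (use gc fg f(3) prod_closed in auto)
  ultimately show ?thesis
    unfolding algebra_iso_def using bij_betw_inv_into[OF f(2)] by blast
qed

text \<open>Coordinates with respect to a natural basis give the isomorphism. All products lie in the
  image of the column space of the structure matrix \<open>A\<close>, so idempotency makes \<open>A\<close> surjective.\<close>

lemma structure_matrix_exists:
  fixes E :: "('a::field, 'v) module"
  assumes E: "E \<in> idempotent_evolution_algebras n"
  shows "\<exists>A \<in> carrier (GL n). algebra_iso (structure_algebra n A) E"
proof -
  from E obtain e where alg: "nonassoc_algebra E" and e: "natural_basis n E e"
    and idem: "idempotent_algebra E"
    unfolding idempotent_evolution_algebras_def evolution_algebra_def by blast
  interpret nonassoc_algebra E by (rule alg)
  note vs = nonassoc_algebra.axioms(1)[OF alg]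
  have inj: "inj_on e {0..<n}" and basis: "basis (e ` {0..<n})"
    and orth: "\<And>i j. i < n \<Longrightarrow> j < n \<Longrightarrow> i \<noteq> j \<Longrightarrow> e i \<otimes>\<^bsub>E\<^esub> e j = \<zero>\<^bsub>E\<^esub>"
    using e unfolding natural_basis_def by auto
  have ec: "e \<in> {0..<n} \<rightarrow> carrier E" using basis unfolding basis_def by auto
  let ?f = "coord_map n e" and ?P = "{x \<otimes>\<^bsub>E\<^esub> y | x y. x \<in> carrier E \<and> y \<in> carrier E}"
  have f: "?f \<in> lin_maps n E" by (rule coord_map_linear[OF vs ec])
  have bij: "bij_betw ?f (carrier_vec n) (carrier E)"
    using basis_iff_coord_map_bij[OF vs ec inj] basis by simp
  have unit: "?f (unit_vec n i) = e i" if "i < n" for i by (rule coord_map_unit_vec[OF vs ec that])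
  let ?g = "inv_into (carrier_vec n) ?f"
  have gc: "?g y \<in> carrier_vec n" and fg: "?f (?g y) = y" if "y \<in> carrier E" for y
    using that bij by (auto simp: bij_betw_def inv_into_into f_inv_into_f)
  define A where "A = mat n n (\<lambda>(i, j). ?g (e j \<otimes>\<^bsub>E\<^esub> e j) $ i)"
  have A: "A \<in> carrier_mat n n" by (simp add: A_def)
  have sq: "e j \<otimes>\<^bsub>E\<^esub> e j \<in> carrier E" if "j < n" for j using ec that by (auto intro: prod_closed)
  have colA: "col A j = ?g (e j \<otimes>\<^bsub>E\<^esub> e j)" if "j < n" for j
    using that gc[OF sq[OF that]] by (intro eq_vecI) (auto simp: A_def)
  have prod: "?f (A *\<^sub>v vec_prod n x y) = ?f x \<otimes>\<^bsub>E\<^esub> ?f y"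
    if "x \<in> carrier_vec n" "y \<in> carrier_vec n" for x y
    using that by (intro product_rule_from_unit_vecs[OF alg f A]) (auto simp: unit orth colA fg sq)
  have iso: "algebra_iso (structure_algebra n A) E"
    unfolding algebra_iso_structure_algebra_iff using f bij prod by blast
  let ?N = "(\<lambda>u. ?f (A *\<^sub>v u)) ` carrier_vec n"
  have Ac: "A *\<^sub>v u \<in> carrier_vec n" if "u \<in> carrier_vec n" for u using A that by simp
  have "submodule class_ring ?N E"
  proof (rule submodule.intro)
    show "Module.module class_ring E" by (rule module_axioms)
    show "?N \<subseteq> carrier E" using lin_maps_closed[OF f] Ac by auto
    show "x \<oplus>\<^bsub>E\<^esub> y \<in> ?N" if "x \<in> ?N" "y \<in> ?N" for x y
    proof -
      obtain u w where u: "u \<in> carrier_vec n" "x = ?f (A *\<^sub>v u)"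
        and w: "w \<in> carrier_vec n" "y = ?f (A *\<^sub>v w)" using \<open>x \<in> ?N\<close> \<open>y \<in> ?N\<close> by (elim imageE) simp
      then have "x \<oplus>\<^bsub>E\<^esub> y = ?f (A *\<^sub>v (u + w))"
        using A by (simp add: mult_add_distrib_mat_vec[of _ n n] lin_maps_add[OF f])
      then show ?thesis using u(1) w(1) by (intro image_eqI[of _ _ "u + w"]) auto
    qed
    have "\<zero>\<^bsub>E\<^esub> = ?f (A *\<^sub>v 0\<^sub>v n)" using lin_maps_zero[OF vs f] by (simp add: mult_mat_zero_vec[OF A])
    then show "\<zero>\<^bsub>E\<^esub> \<in> ?N" by (intro image_eqI[of _ _ "0\<^sub>v n"]) auto
    show "c \<odot>\<^bsub>E\<^esub> x \<in> ?N" if "c \<in> carrier class_ring" "x \<in> ?N" for c x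
    proof -
      obtain u where u: "u \<in> carrier_vec n" "x = ?f (A *\<^sub>v u)" using \<open>x \<in> ?N\<close> by (elim imageE) simp
      then have "c \<odot>\<^bsub>E\<^esub> x = ?f (A *\<^sub>v (c \<cdot>\<^sub>v u))"
        using A by (simp add: mult_mat_vec[of _ n n] lin_maps_smult[OF f])
      then show ?thesis using u(1) by (intro image_eqI[of _ _ "c \<cdot>\<^sub>v u"]) auto
    qed
  qed
  moreover have "?P \<subseteq> ?N"
  proof
    fix p assume "p \<in> ?P"
    then obtain x y where p: "p = x \<otimes>\<^bsub>E\<^esub> y" "x \<in> carrier E" "y \<in> carrier E" by blast
    then have "p = ?f (A *\<^sub>v vec_prod n (?g x) (?g y))" using prod gc fg by simp
    then show "p \<in> ?N" by (intro image_eqI[of _ _ "vec_prod n (?g x) (?g y)"]) auto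
  qed
  ultimately have "carrier E \<subseteq> ?N"
    using span_is_subset[of ?P ?N] idem unfolding idempotent_algebra_def by simp
  then have "\<exists>u \<in> carrier_vec n. A *\<^sub>v u = v" if v: "v \<in> carrier_vec n" for v
  proof -
    have "?f v \<in> ?N" using \<open>carrier E \<subseteq> ?N\<close> lin_maps_closed[OF f v] by (rule subsetD)
    then obtain u where u: "u \<in> carrier_vec n" "?f v = ?f (A *\<^sub>v u)" by (elim imageE) simp
    then have "v = A *\<^sub>v u" using inj_onD[OF bij_betw_imp_inj_on[OF bij]] v Ac by blast
    then show ?thesis using u(1) by blast
  qed
  then have "A \<in> carrier (GL n)" by (rule GL_I_surj[OF A])
  then show ?thesis using iso by blast
qed

text \<open>Conversely, the image of the unit vectors is a natural basis, and the squares of the unit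
  vectors, which are the columns of an invertible matrix, already span.\<close>

lemma idempotent_evolution_algebraI:
  fixes E :: "('a::field, 'v) module"
  assumes alg: "nonassoc_algebra E" and A: "A \<in> carrier (GL n)"
    and iso: "algebra_iso (structure_algebra n A) E"
  shows "E \<in> idempotent_evolution_algebras n"
proof -
  interpret nonassoc_algebra E by (rule alg)
  note vs = nonassoc_algebra.axioms(1)[OF alg]
  have Ac: "A \<in> carrier_mat n n" by (rule GL_carrier_mat[OF A])
  obtain f where f: "f \<in> lin_maps n E" and bij: "bij_betw f (carrier_vec n) (carrier E)"
    and prod: "\<And>x y. x \<in> carrier_vec n \<Longrightarrow> y \<in> carrier_vec n \<Longrightarrow>
      f (A *\<^sub>v vec_prod n x y) = f x \<otimes>\<^bsub>E\<^esub> f y"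
    using iso unfolding algebra_iso_structure_algebra_iff by blast
  let ?e = "\<lambda>i. f (unit_vec n i)"
  let ?P = "{x \<otimes>\<^bsub>E\<^esub> y | x y. x \<in> carrier E \<and> y \<in> carrier E}"
  have ec: "?e \<in> {0..<n} \<rightarrow> carrier E" using lin_maps_closed[OF f] by auto
  have inj: "inj_on ?e {0..<n}"
  proof (rule inj_onI)
    fix i j assume "i \<in> {0..<n}" "j \<in> {0..<n}" "?e i = ?e j"
    then show "i = j" using inj_onD[OF bij_betw_imp_inj_on[OF bij], of "unit_vec n i" "unit_vec n j"]
      by simp
  qed
  have "coord_map n ?e v = f v" if "v \<in> carrier_vec n" for v
    by (rule lin_maps_eqI[OF vs coord_map_linear[OF vs ec] f coord_map_unit_vec[OF vs ec] that])
  then have "bij_betw (coord_map n ?e) (carrier_vec n) (carrier E)"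
    using bij by (simp cong: bij_betw_cong)
  then have "basis (?e ` {0..<n})" using basis_iff_coord_map_bij[OF vs ec inj] by simp
  moreover have "?e i \<otimes>\<^bsub>E\<^esub> ?e j = \<zero>\<^bsub>E\<^esub>" if "i < n" "j < n" "i \<noteq> j" for i j
  proof -
    have "A *\<^sub>v 0\<^sub>v n = 0\<^sub>v n" using Ac by auto
    then show ?thesis
      using prod[of "unit_vec n i" "unit_vec n j"] that lin_maps_zero[OF vs f] by (simp add: vec_prod_unit)
  qed
  ultimately have nat: "natural_basis n E ?e" using inj by (simp add: natural_basis_def)
  have PE: "?P \<subseteq> carrier E" using prod_closed by blast
  have sub: "submodule class_ring (span ?P) E" by (rule span_is_submodule[OF PE])
  have "f (A *\<^sub>v u) \<in> span ?P" if "u \<in> carrier_vec n" for u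
    using that
  proof (induction rule: carrier_vec_induct)
    case zero
    have "A *\<^sub>v 0\<^sub>v n = 0\<^sub>v n" using Ac by auto
    then show ?case using submodule.zero_closed[OF sub] lin_maps_zero[OF vs f] by simp
  next
    case (unit i c)
    have "f (A *\<^sub>v unit_vec n i) = ?e i \<otimes>\<^bsub>E\<^esub> ?e i"
      using prod[of "unit_vec n i" "unit_vec n i"] unit by (simp add: vec_prod_unit)
    moreover have "?e i \<in> carrier E" using ec unit by auto
    ultimately have "f (A *\<^sub>v unit_vec n i) \<in> ?P" by blast
    then have "f (A *\<^sub>v unit_vec n i) \<in> span ?P" using in_own_span[OF PE] by (rule rev_subsetD)
    then have "c \<odot>\<^bsub>E\<^esub> f (A *\<^sub>v unit_vec n i) \<in> span ?P"
      by (intro submodule.smult_closed[OF sub]) simp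
    then show ?case using Ac by (simp add: mult_mat_vec[of _ n n] lin_maps_smult[OF f])
  next
    case (add x y)
    then show ?case using Ac submodule.m_closed[OF sub]
      by (simp add: mult_add_distrib_mat_vec[of _ n n] lin_maps_add[OF f])
  qed
  moreover have "\<exists>u \<in> carrier_vec n. y = f (A *\<^sub>v u)" if "y \<in> carrier E" for y
  proof -
    have "y \<in> f ` carrier_vec n" using that bij by (simp add: bij_betw_def)
    then obtain v where v: "v \<in> carrier_vec n" "y = f v" by (elim imageE) simp
    obtain u where "u \<in> carrier_vec n" "A *\<^sub>v u = v" using GL_surj[OF A v(1)] by (elim bexE) simp
    then show ?thesis using v(2) by blast
  qed
  ultimately have "carrier E \<subseteq> span ?P" by fastforce
  then have "idempotent_algebra E"
    unfolding idempotent_algebra_def by (rule Set.equalityI[OF span_is_subset2[OF PE]])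
  moreover have "evolution_algebra n E"
    unfolding evolution_algebra_def by (intro conjI alg exI[of _ ?e] nat)
  ultimately show ?thesis by (simp add: idempotent_evolution_algebras_def)
qed

text \<open>Transport of structure. It is needed to realize an algebra given on coordinate space inside
  an arbitrary type that is large enough.\<close>

lemma nonassoc_algebra_transport:
  fixes E :: "('a::field, 'v) module" and h :: "'v \<Rightarrow> 'w"
  assumes E: "nonassoc_algebra E" and inj: "inj_on h (carrier E)"
  shows "\<exists>F :: ('a, 'w) module. nonassoc_algebra F \<and> algebra_iso E F"
proof -
  interpret nonassoc_algebra E by (rule E)
  let ?g = "inv_into (carrier E) h"
  define F :: "('a, 'w) module" where
    "F = \<lparr>carrier = h ` carrier E, monoid.mult = \<lambda>x y. h (?g x \<otimes>\<^bsub>E\<^esub> ?g y), one = undefined,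
      zero = h \<zero>\<^bsub>E\<^esub>, add = \<lambda>x y. h (?g x \<oplus>\<^bsub>E\<^esub> ?g y), smult = \<lambda>c x. h (c \<odot>\<^bsub>E\<^esub> ?g x)\<rparr>"
  have gh: "?g (h x) = x" if "x \<in> carrier E" for x using inj that by simp
  have F: "carrier F = h ` carrier E" "\<zero>\<^bsub>F\<^esub> = h \<zero>\<^bsub>E\<^esub>"
    "\<And>x y. x \<otimes>\<^bsub>F\<^esub> y = h (?g x \<otimes>\<^bsub>E\<^esub> ?g y)" "\<And>x y. x \<oplus>\<^bsub>F\<^esub> y = h (?g x \<oplus>\<^bsub>E\<^esub> ?g y)"
    "\<And>c x. c \<odot>\<^bsub>F\<^esub> x = h (c \<odot>\<^bsub>E\<^esub> ?g x)"
    by (simp_all add: F_def)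
  have sc: "c \<odot>\<^bsub>E\<^esub> x \<in> carrier E" if "x \<in> carrier E" for c x using smult_closed that by simp
  note axs = gh prod_closed sc prod_l_distr prod_r_distr prod_smult_l prod_smult_r
    smult_assoc1[simplified] smult_l_distr[simplified] smult_r_distr[simplified] smult_one[simplified]
  have "nonassoc_algebra F"
  proof (intro nonassoc_algebra.intro nonassoc_algebra_axioms.intro)
    have neg: "\<exists>w \<in> carrier F. v \<oplus>\<^bsub>F\<^esub> w = \<zero>\<^bsub>F\<^esub>" if v: "v \<in> carrier F" for v
    proof -
      obtain x where x: "x \<in> carrier E" "v = h x" using v unfolding F by (elim imageE) simp
      have "v \<oplus>\<^bsub>F\<^esub> h (\<ominus>\<^bsub>E\<^esub> x) = \<zero>\<^bsub>F\<^esub>" using x by (simp add: F gh r_neg)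
      then show ?thesis using x by (intro bexI[of _ "h (\<ominus>\<^bsub>E\<^esub> x)"]) (auto simp: F)
    qed
    show "vectorspace class_ring F"
    proof (rule vs_criteria[OF class_field])
      show "\<forall>v\<in>carrier F. \<exists>w\<in>carrier F. v \<oplus>\<^bsub>F\<^esub> w = \<zero>\<^bsub>F\<^esub>" using neg by blast
      show "\<forall>v w. v \<in> carrier F \<and> w \<in> carrier F \<longrightarrow> v \<oplus>\<^bsub>F\<^esub> w = w \<oplus>\<^bsub>F\<^esub> v"
        by (auto simp: F gh a_comm)
    qed (auto simp: F axs a_assoc)
  qed (auto simp: F axs)
  moreover have "algebra_iso E F"
    unfolding algebra_iso_def
  proof (intro bexI[of _ h] conjI)
    show "h \<in> LinearCombinations.module_hom class_ring E F"
      unfolding LinearCombinations.module_hom_def by (auto simp: F gh)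
  qed (use inj in \<open>auto simp: F gh bij_betw_def\<close>)
  ultimately show ?thesis by blast
qed

text \<open>Stated at the position \<open>\<sigma> k\<close>, so that no inverse of \<open>\<sigma>\<close> enters.\<close>

lemma mono_mat_mult_vec_index:
  assumes \<sigma>: "\<sigma> permutes {0..<n}" and x: "x \<in> carrier_vec n" and k: "k < n"
  shows "(mono_mat n \<sigma> d *\<^sub>v x) $ (\<sigma> k) = d k * x $ k"
proof -
  have sk: "\<sigma> k < n" using permutes_in_image[OF \<sigma>, of k] k by simp
  have "(mono_mat n \<sigma> d *\<^sub>v x) $ (\<sigma> k) = (\<Sum>j = 0..<n. (if \<sigma> k = \<sigma> j then d j else 0) * x $ j)"
    using sk x by (simp add: mono_mat_def scalar_prod_def)
  also have "\<dots> = (\<Sum>j = 0..<n. if k = j then d j * x $ j else 0)"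
    by (rule sum.cong) (auto dest: injD[OF permutes_inj[OF \<sigma>]])
  also have "\<dots> = d k * x $ k" using k by simp
  finally show ?thesis .
qed

text \<open>A monomial matrix moves and scales entries without mixing them; therefore it is
  compatible with entrywise products up to squaring its own entries. This makes the converse
  direction of \<open>structure_algebra_iso_iff\<close> work.\<close>

lemma square_entries_mult_vec_prod:
  assumes g: "g \<in> carrier (monomial_group n)" and x: "x \<in> carrier_vec n" and y: "y \<in> carrier_vec n"
  shows "square_entries g *\<^sub>v vec_prod n x y = vec_prod n (g *\<^sub>v x) (g *\<^sub>v y)"
proof -
  obtain \<sigma> d where \<sigma>: "\<sigma> permutes {0..<n}" and gd: "g = mono_mat n \<sigma> d"
    using g unfolding monomial_group_carrier by blast
  show ?thesis
  proof (rule eq_vecI)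
    fix i assume "i < dim_vec (vec_prod n (g *\<^sub>v x) (g *\<^sub>v y))"
    then have i: "i < n" by simp
    obtain k where k: "k < n" "i = \<sigma> k"
      using permutes_image[OF \<sigma>] i by (metis atLeastLessThan_iff imageE zero_le)
    have sk: "\<sigma> k < n" using i k by simp
    show "(square_entries g *\<^sub>v vec_prod n x y) $ i = vec_prod n (g *\<^sub>v x) (g *\<^sub>v y) $ i"
      unfolding gd square_entries_mono_mat k(2)
      using sk k(1) x y by (simp add: mono_mat_mult_vec_index[OF \<sigma>])
  qed (simp add: gd mono_mat_def)
qed

text \<open>Orthogonality leaves at most one nonzero entry in each row, and invertibility gives at
  least one in each column; sending a column to the row of such an entry is then injective,
  hence a permutation.\<close>

lemma monomial_if_orthogonal_columns:
  fixes P :: "'a::field mat"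
  assumes P: "P \<in> carrier (GL n)"
    and orth: "\<And>i j. i < n \<Longrightarrow> j < n \<Longrightarrow> i \<noteq> j \<Longrightarrow> vec_prod n (col P i) (col P j) = 0\<^sub>v n"
  shows "P \<in> carrier (monomial_group n)"
proof -
  have Pc: "P \<in> carrier_mat n n" by (rule GL_carrier_mat[OF P])
  have row: "P $$ (k, i) = 0 \<or> P $$ (k, j) = 0" if "k < n" "i < n" "j < n" "i \<noteq> j" for k i j
    using arg_cong[OF orth[OF that(2,3,4)], of "\<lambda>v. v $ k"] that Pc by simp
  have col: "\<exists>k<n. P $$ (k, j) \<noteq> 0" if j: "j < n" for j
  proof (rule ccontr)
    assume "\<not> (\<exists>k<n. P $$ (k, j) \<noteq> 0)"
    then have "col P j = 0\<^sub>v n" using Pc j by (intro eq_vecI) auto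
    then have "P *\<^sub>v unit_vec n j = P *\<^sub>v 0\<^sub>v n" using mult_mat_unit_vec[OF Pc j] Pc by auto
    then have "unit_vec n j = (0\<^sub>v n :: 'a vec)" 
      by (rule GL_inj[OF P unit_vec_carrier zero_carrier_vec])
    then show False using j by simp
  qed
  then obtain s where s: "\<And>j. j < n \<Longrightarrow> s j < n \<and> P $$ (s j, j) \<noteq> 0" by metis
  define \<sigma> where "\<sigma> = (\<lambda>j. if j < n then s j else j)"
  have \<sigma>s: "\<sigma> j < n" "P $$ (\<sigma> j, j) \<noteq> 0" if "j < n" for j using s[OF that] that by (auto simp: \<sigma>_def)
  have inj: "inj_on \<sigma> {0..<n}"
  proof (rule inj_onI)
    fix i j assume ij: "i \<in> {0..<n}" "j \<in> {0..<n}" "\<sigma> i = \<sigma> j"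
    then show "i = j" using row[of "\<sigma> i" i j] \<sigma>s[of i] \<sigma>s[of j] by auto
  qed
  have "\<sigma> ` {0..<n} = {0..<n}" using \<sigma>s(1) by (intro endo_inj_surj[OF _ _ inj]) auto
  then have \<sigma>: "\<sigma> permutes {0..<n}"
    using inj by (intro bij_imp_permutes) (auto simp: bij_betw_def \<sigma>_def)
  have "P = mono_mat n \<sigma> (\<lambda>j. P $$ (\<sigma> j, j))"
  proof (rule eq_matI)
    fix i j assume "i < dim_row (mono_mat n \<sigma> (\<lambda>j. P $$ (\<sigma> j, j)))"
      "j < dim_col (mono_mat n \<sigma> (\<lambda>j. P $$ (\<sigma> j, j)))"
    then have ij: "i < n" "j < n" by (auto simp: mono_mat_def)
    show "P $$ (i, j) = mono_mat n \<sigma> (\<lambda>j. P $$ (\<sigma> j, j)) $$ (i, j)"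
    proof (cases "i = \<sigma> j")
      case False
      obtain k where k: "k < n" "i = \<sigma> k"
        using \<open>\<sigma> ` {0..<n} = {0..<n}\<close> ij(1) by (metis atLeastLessThan_iff imageE zero_le)
      then have "k \<noteq> j" using False by blast
      then have "P $$ (i, j) = 0" using row[of i k j] \<sigma>s[OF k(1)] k ij by auto
      then show ?thesis using False ij by (simp add: mono_mat_def)
    qed (use ij in \<open>simp add: mono_mat_def\<close>)
  qed (use Pc in \<open>auto simp: mono_mat_def\<close>)
  moreover have "mono_mat n \<sigma> (\<lambda>j. P $$ (\<sigma> j, j)) \<in> carrier (monomial_group n)"
    by (rule mono_mat_in_monomial_group[OF \<sigma>]) (simp add: \<sigma>s(2))
  ultimately show ?thesis by (simp only:)
qed

text \<open>An isomorphism is multiplication by an invertible matrix \<open>P\<close>. Multiplicativity on two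
  different unit vectors makes \<open>P\<close> monomial, as \<open>B\<close> is injective; on the square of the \<open>j\<close>-th
  unit vector it compares the \<open>j\<close>-th columns of \<open>P A\<close> and \<open>B P\<^sup>(\<^sup>2\<^sup>)\<close>.\<close>

lemma structure_algebra_iso_iff:
  fixes A B :: "'a::field mat"
  assumes A: "A \<in> carrier (GL n)" and B: "B \<in> carrier (GL n)"
  shows "algebra_iso (structure_algebra n A) (structure_algebra n B) \<longleftrightarrow>
    (\<exists>g \<in> carrier (monomial_group n). A = monomial_act n g B)"
proof
  interpret G: group "GL n :: 'a mat monoid" by (rule group_GL)
  have Ac: "A \<in> carrier_mat n n" and Bc: "B \<in> carrier_mat n n" using GL_carrier_mat[OF A] GL_carrier_mat[OF B] by this
  {
    assume "algebra_iso (structure_algebra n A) (structure_algebra n B)"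
    then obtain f where f: "f \<in> lin_maps n (structure_algebra n B)"
      and bij: "bij_betw f (carrier_vec n) (carrier_vec n)"
      and prod: "\<And>x y. x \<in> carrier_vec n \<Longrightarrow> y \<in> carrier_vec n \<Longrightarrow>
        f (A *\<^sub>v vec_prod n x y) = B *\<^sub>v vec_prod n (f x) (f y)"
      unfolding algebra_iso_structure_algebra_iff by auto
    have vs: "vectorspace class_ring (structure_algebra n B)"
      by (rule nonassoc_algebra.axioms(1)[OF structure_algebra_nonassoc[OF Bc]])
    define P where "P = mat n n (\<lambda>(i, j). f (unit_vec n j) $ i)"
    have Pc: "P \<in> carrier_mat n n" by (simp add: P_def)
    have fc: "f v \<in> carrier_vec n" if "v \<in> carrier_vec n" for v using lin_maps_closed[OF f that] by simp
    have colP: "col P j = f (unit_vec n j)" if "j < n" for j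
      using that fc[of "unit_vec n j"] by (intro eq_vecI) (auto simp: P_def)
    have fP: "f v = P *\<^sub>v v" if "v \<in> carrier_vec n" for v
      by (rule lin_maps_eqI[OF vs f mult_mat_vec_lin_maps[OF Pc] _ that])
        (simp add: mult_mat_unit_vec[OF Pc] colP)
    have P: "P \<in> carrier (GL n)"
    proof (rule GL_I_surj[OF Pc])
      fix v :: "'a vec" assume "v \<in> carrier_vec n"
      then have "v \<in> f ` carrier_vec n" using bij by (simp add: bij_betw_def)
      then obtain u where "u \<in> carrier_vec n" "v = f u" by (elim imageE) simp
      then show "\<exists>u \<in> carrier_vec n. P *\<^sub>v u = v" using fP by auto
    qed
    have PM: "P \<in> carrier (monomial_group n)"
    proof (rule monomial_if_orthogonal_columns[OF P])
      fix i j assume ij: "i < n" "j < n" "i \<noteq> j"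
      have "A *\<^sub>v 0\<^sub>v n = 0\<^sub>v n" "B *\<^sub>v 0\<^sub>v n = 0\<^sub>v n" using Ac Bc by auto
      then have "B *\<^sub>v vec_prod n (col P i) (col P j) = B *\<^sub>v 0\<^sub>v n"
        using prod[of "unit_vec n i" "unit_vec n j"] ij lin_maps_zero[OF vs f]
        by (simp add: colP vec_prod_unit)
      then show "vec_prod n (col P i) (col P j) = 0\<^sub>v n" by (rule GL_inj[OF B, rotated 2]) auto
    qed
    let ?Q = "square_entries P"
    have Qc: "?Q \<in> carrier_mat n n" using Pc by simp
    have PA: "P * A = B * ?Q"
    proof (rule mat_col_eqI)
      fix j assume "j < dim_col (B * ?Q)"
      then have j: "j < n" using Pc by simp
      have "col (P * A) j = P *\<^sub>v (A *\<^sub>v unit_vec n j)"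
        using mult_mat_unit_vec[of "P * A" n j] Pc Ac j assoc_mult_mat_vec[OF Pc Ac, of "unit_vec n j"] by simp
      also have "\<dots> = f (A *\<^sub>v vec_prod n (unit_vec n j) (unit_vec n j))"
        using j Ac by (simp add: vec_prod_unit fP)
      also have "\<dots> = B *\<^sub>v vec_prod n (col P j) (col P j)" using j by (simp add: prod colP)
      also have "vec_prod n (col P j) (col P j) = ?Q *\<^sub>v unit_vec n j"
        using mult_mat_unit_vec[OF Qc j] j Pc by (auto intro!: eq_vecI)
      also have "B *\<^sub>v (?Q *\<^sub>v unit_vec n j) = col (B * ?Q) j"
        using mult_mat_unit_vec[of "B * ?Q" n j] Qc Bc j assoc_mult_mat_vec[OF Bc Qc, of "unit_vec n j"] by simp
      finally show "col (P * A) j = col (B * ?Q) j" .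
    qed (use Pc Ac Bc in auto)
    have iP: "inv\<^bsub>GL n\<^esub> P \<in> carrier_mat n n" using G.inv_closed[OF P] by (rule GL_carrier_mat)
    have "monomial_act n P B = inv\<^bsub>GL n\<^esub> P * (B * ?Q)"
      using monomial_act_eq_squares[OF PM Bc] iP Bc Qc by (simp add: assoc_mult_mat[of _ n n _ n _ n])
    also have "\<dots> = (inv\<^bsub>GL n\<^esub> P * P) * A"
      unfolding PA[symmetric] using iP Pc Ac by (simp add: assoc_mult_mat[of _ n n _ n _ n])
    also have "\<dots> = A" using G.l_inv[OF P] Ac by simp
    finally show "\<exists>g \<in> carrier (monomial_group n). A = monomial_act n g B" using PM by metis
  }
  {
    assume "\<exists>g \<in> carrier (monomial_group n). A = monomial_act n g B"
    then obtain g where g: "g \<in> carrier (monomial_group n)" and Ag: "A = monomial_act n g B" by blast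
    have gG: "g \<in> carrier (GL n)" using g monomial_subgroup[of n] by (auto dest: subgroup.mem_carrier)
    let ?Q = "square_entries g" and ?i = "inv\<^bsub>GL n\<^esub> g"
    have c: "g \<in> carrier_mat n n" "?Q \<in> carrier_mat n n" "?i \<in> carrier_mat n n"
      using gG square_entries_in_GL[OF g] by (auto intro: GL_carrier_mat)
    have "g * A = g * ?i * B * ?Q"
      unfolding Ag monomial_act_eq_squares[OF g Bc] using c Bc
      by (simp add: assoc_mult_mat[of _ n n _ n _ n])
    then have gA: "g * A = B * ?Q" using G.r_inv[OF gG] Bc by simp
    have "g *\<^sub>v (A *\<^sub>v vec_prod n x y) = B *\<^sub>v vec_prod n (g *\<^sub>v x) (g *\<^sub>v y)"
      if "x \<in> carrier_vec n" "y \<in> carrier_vec n" for x y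
    proof -
      have "g *\<^sub>v (A *\<^sub>v vec_prod n x y) = (g * A) *\<^sub>v vec_prod n x y"
        by (rule assoc_mult_mat_vec[OF c(1) Ac, symmetric]) simp
      also have "\<dots> = B *\<^sub>v (?Q *\<^sub>v vec_prod n x y)"
        unfolding gA by (rule assoc_mult_mat_vec[OF Bc c(2)]) simp
      finally show ?thesis unfolding square_entries_mult_vec_prod[OF g that] .
    qed
    moreover have "bij_betw ((*\<^sub>v) g) (carrier_vec n) (carrier_vec n)"
      unfolding bij_betw_def
    proof
      show "inj_on ((*\<^sub>v) g) (carrier_vec n)" using GL_inj[OF gG] by (rule inj_onI)
      show "(*\<^sub>v) g ` carrier_vec n = carrier_vec n"
        using GL_surj[OF gG] c(1) by (auto simp: image_iff)
    qed
    ultimately show "algebra_iso (structure_algebra n A) (structure_algebra n B)"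
      unfolding algebra_iso_structure_algebra_iff
      using mult_mat_vec_lin_maps[OF c(1), of B] by auto
  }
qed

section \<open>Isomorphism classes and orbits\<close>

lemma orbit_eq_iff:
  fixes A B :: "'a::field mat"
  assumes A: "A \<in> carrier (GL n)" and B: "B \<in> carrier (GL n)"
  shows "orbit (monomial_group n) (monomial_act n) A = orbit (monomial_group n) (monomial_act n) B \<longleftrightarrow>
    (\<exists>g \<in> carrier (monomial_group n). A = monomial_act n g B)"
proof -
  interpret M: group "monomial_group n :: 'a mat monoid" by (rule monomial_group_group)
  have sub: "orbit (monomial_group n) (monomial_act n) (monomial_act n g C) \<subseteq>
      orbit (monomial_group n) (monomial_act n) C"
    if g: "g \<in> carrier (monomial_group n)" and C: "C \<in> carrier (GL n)" for g C :: "'a mat"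
  proof
    fix D assume "D \<in> orbit (monomial_group n) (monomial_act n) (monomial_act n g C)"
    then obtain h where h: "h \<in> carrier (monomial_group n)" "D = monomial_act n h (monomial_act n g C)"
      unfolding orbit_def by blast
    then have "D = monomial_act n (g * h) C" using monomial_act_mult[OF g h(1) C] by simp
    moreover have "g * h \<in> carrier (monomial_group n)" using M.m_closed[OF g h(1)] by simp
    ultimately show "D \<in> orbit (monomial_group n) (monomial_act n) C" unfolding orbit_def by blast
  qed
  show ?thesis
  proof
    assume eq: "orbit (monomial_group n) (monomial_act n) A = orbit (monomial_group n) (monomial_act n) B"
    have "A = monomial_act n (1\<^sub>m n) A" using monomial_act_one[OF A] by simp
    then have "A \<in> orbit (monomial_group n) (monomial_act n) A"
      unfolding orbit_def using M.one_closed by auto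
    then show "\<exists>g \<in> carrier (monomial_group n). A = monomial_act n g B"
      unfolding eq unfolding orbit_def by blast
  next
    assume "\<exists>g \<in> carrier (monomial_group n). A = monomial_act n g B"
    then obtain g where g: "g \<in> carrier (monomial_group n)" and Ag: "A = monomial_act n g B" by blast
    let ?i = "inv\<^bsub>monomial_group n\<^esub> g"
    have i: "?i \<in> carrier (monomial_group n)" using g by (rule M.inv_closed)
    have "monomial_act n ?i A = B"
      using monomial_act_mult[OF g i B] M.r_inv[OF g] monomial_act_one[OF B] Ag by simp
    then show "orbit (monomial_group n) (monomial_act n) A = orbit (monomial_group n) (monomial_act n) B"
      using sub[OF g B] sub[OF i A] Ag by auto
  qed
qed

lemma finite_carrier_vec: "finite (carrier_vec n :: 'a::finite vec set)"
proof -
  have "v \<in> vec n ` ({0..<n} \<rightarrow>\<^sub>E UNIV)" if "v \<in> carrier_vec n" for v :: "'a vec"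
  proof (rule image_eqI)
    show "v = vec n (restrict (($) v) {0..<n})" by (rule eq_vecI) (use that in auto)
  qed auto
  then have "carrier_vec n \<subseteq> vec n ` ({0..<n} \<rightarrow>\<^sub>E (UNIV :: 'a set))" by blast
  moreover have "finite ({0..<n} \<rightarrow>\<^sub>E (UNIV :: 'a set))" by (intro finite_PiE) auto
  ultimately show ?thesis by (rule finite_subset[OF _ finite_imageI])
qed

text \<open>Coordinate space over a finite field is finite, so it embeds into any infinite type.\<close>

lemma algebra_with_structure_matrix_exists:
  fixes A :: "'a::{field,finite} mat"
  assumes A: "A \<in> carrier (GL n)" and inf: "infinite (UNIV :: 'v set)"
  shows "\<exists>E :: ('a, 'v) module. E \<in> idempotent_evolution_algebras n \<and> algebra_iso (structure_algebra n A) E"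
proof -
  let ?C = "carrier_vec n :: 'a vec set"
  obtain B :: "'v set" where B: "finite B" "card B = card ?C"
    using infinite_arbitrarily_large[OF inf] by blast
  obtain h where "h ` ?C \<subseteq> B" and h: "inj_on h ?C"
    using card_le_inj[OF finite_carrier_vec[of n, where 'a = 'a] B(1)] B(2) by auto
  have alg: "nonassoc_algebra (structure_algebra n A)"
    by (rule structure_algebra_nonassoc[OF GL_carrier_mat[OF A]])
  obtain E :: "('a, 'v) module" where "nonassoc_algebra E" "algebra_iso (structure_algebra n A) E"
    using nonassoc_algebra_transport[OF alg, of h] h by auto
  then show ?thesis using idempotent_evolution_algebraI[OF _ A] by blast
qed

lemma card_image_eq_if_same_kernel:
  assumes "\<And>x y. x \<in> X \<Longrightarrow> y \<in> X \<Longrightarrow> f x = f y \<longleftrightarrow> g x = g y"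
  shows "card (f ` X) = card (g ` X)"
proof (rule bij_betw_same_card[OF bij_betwI'])
  let ?h = "\<lambda>c. g (inv_into X f c)"
  have h: "?h (f x) = g x" if "x \<in> X" for x
    using assms[of "inv_into X f (f x)" x] that by (simp add: inv_into_into f_inv_into_f)
  show "?h c = ?h d \<longleftrightarrow> c = d" if "c \<in> f ` X" "d \<in> f ` X" for c d
    using that h assms by auto
  show "?h c \<in> g ` X" if "c \<in> f ` X" for c using that by (simp add: inv_into_into)
  show "\<exists>c \<in> f ` X. d = ?h c" if "d \<in> g ` X" for d
    using that h by auto
qed

text \<open>Sending \<open>A\<close> to the class of all algebras isomorphic to the structure algebra of \<open>A\<close> reaches every class
  and identifies two matrices precisely when they lie in the same orbit.\<close>

lemma num_iso_classes_eq_card_orbits: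
  assumes inf: "infinite (UNIV :: 'v set)"
  shows "num_iso_classes TYPE('a::{field,finite}) TYPE('v) n =
    card (orbits (monomial_group n :: 'a mat monoid) (carrier (GL n)) (monomial_act n))"
proof -
  let ?X = "carrier (GL n) :: 'a mat set" and ?S = "structure_algebra n :: 'a mat \<Rightarrow> _"
  let ?orb = "orbit (monomial_group n) (monomial_act n) :: 'a mat \<Rightarrow> _"
  define \<E> where "\<E> = (idempotent_evolution_algebras n :: ('a, 'v) module set)"
  define R where "R = {(E, F). E \<in> \<E> \<and> F \<in> \<E> \<and> algebra_iso E F}"
  define cls where "cls A = {E \<in> \<E>. algebra_iso (?S A) E}" for A
  have alg: "nonassoc_algebra (?S A)" if "A \<in> ?X" for A
    by (rule structure_algebra_nonassoc[OF GL_carrier_mat[OF that]])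
  have class_eq: "R `` {E} = cls A" if "A \<in> ?X" "E \<in> cls A" for A E
  proof -
    have E: "E \<in> \<E>" "algebra_iso (?S A) E" using that(2) by (simp_all add: cls_def)
    have "algebra_iso E F \<longleftrightarrow> algebra_iso (?S A) F" for F :: "('a, 'v) module"
      using algebra_iso_trans[OF E(2)] algebra_iso_trans[OF algebra_iso_sym[OF alg[OF that(1)] E(2)]]
      by blast
    then show ?thesis using E(1) unfolding R_def cls_def by blast
  qed
  have ne: "\<exists>E. E \<in> cls A" if "A \<in> ?X" for A
    using algebra_with_structure_matrix_exists[OF that inf] unfolding cls_def \<E>_def by blast
  have "\<E> // R = cls ` ?X"
  proof (intro Set.equalityI subsetI)
    fix c assume "c \<in> \<E> // R"
    then obtain E where E: "E \<in> \<E>" "c = R `` {E}" by (rule quotientE)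
    obtain A where A: "A \<in> ?X" "algebra_iso (?S A) E"
      using structure_matrix_exists E(1) unfolding \<E>_def by blast
    then have "c = cls A" using class_eq[OF A(1)] E by (simp add: cls_def)
    then show "c \<in> cls ` ?X" using A(1) by (rule image_eqI)
  next
    fix c assume "c \<in> cls ` ?X"
    then obtain A where A: "A \<in> ?X" "c = cls A" by (elim imageE) simp
    obtain E where E: "E \<in> cls A" using ne[OF A(1)] by blast
    then have "c = R `` {E}" using class_eq[OF A(1) E] A(2) by simp
    moreover have "E \<in> \<E>" using E by (simp add: cls_def)
    ultimately show "c \<in> \<E> // R" by (auto intro: quotientI)
  qed
  moreover have "cls A = cls B \<longleftrightarrow> ?orb A = ?orb B" if A: "A \<in> ?X" and B: "B \<in> ?X" for A B
  proof -
    have "cls A = cls B \<longleftrightarrow> algebra_iso (?S A) (?S B)"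
    proof
      assume eq: "cls A = cls B"
      obtain E where E: "E \<in> cls A" using ne[OF A] by blast
      then have "E \<in> cls B" using eq by simp
      with E have "algebra_iso (?S A) E" "algebra_iso (?S B) E" by (simp_all add: cls_def)
      then show "algebra_iso (?S A) (?S B)"
        using algebra_iso_trans algebra_iso_sym[OF alg[OF B]] by blast
    next
      assume iso: "algebra_iso (?S A) (?S B)"
      have "algebra_iso (?S A) E \<longleftrightarrow> algebra_iso (?S B) E" for E :: "('a, 'v) module"
        using algebra_iso_trans[OF iso] algebra_iso_trans[OF algebra_iso_sym[OF alg[OF A] iso]] by blast
      then show "cls A = cls B" by (simp add: cls_def)
    qed
    also have "\<dots> \<longleftrightarrow> ?orb A = ?orb B"
      using structure_algebra_iso_iff[OF A B] orbit_eq_iff[OF A B] by simp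
    finally show ?thesis .
  qed
  then have "card (cls ` ?X) = card (?orb ` ?X)" by (rule card_image_eq_if_same_kernel)
  moreover have "orbits (monomial_group n) ?X (monomial_act n) = ?orb ` ?X"
    unfolding orbits_def by blast
  ultimately show ?thesis by (simp add: num_iso_classes_def Let_def \<E>_def R_def)
qed

section \<open>The partition formula\<close>

lemma card_orbits_eq_partition_sum:
  "real (card (orbits (monomial_group n :: 'a::{field,finite} mat monoid) (carrier (GL n)) (monomial_act n)))
     = (\<Sum>\<mu> \<in> partitions n. B_coeff TYPE('a) n \<mu>) / (real CARD('a) - 1) ^ n"
proof -
  let ?F = "\<lambda>g :: 'a mat. real (card (invariants (carrier (GL n)) (monomial_act n) g))"
  let ?h = "\<lambda>\<sigma>. \<Sum>t\<in>diag_subgroup n. ?F (perm_mat n \<sigma> * t)"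
  let ?k = "card (orbits (monomial_group n :: 'a mat monoid) (carrier (GL n)) (monomial_act n))"
  \<comment> \<open>A field has at least two elements, so the divisor \<open>(q - 1)\<^sup>n\<close> is nonzero.\<close>
  have "card {0 :: 'a, 1} \<le> CARD('a)" by (rule card_mono) auto
  then have q: "2 \<le> CARD('a)" by simp
  have "real (?k * (fact n * (CARD('a) - 1) ^ n)) = (\<Sum>\<sigma> | \<sigma> permutes {0..<n}. ?h \<sigma>)"
    unfolding burnside_monomial by simp
  also have "\<dots> = fact n * (\<Sum>\<mu>\<in>partitions n. ?h (partition_perm \<mu>) / real (d_coeff n \<mu>))"
    by (rule sum_class_function) (rule sum_invariants_conj)
  also have "\<dots> = fact n * (\<Sum>\<mu>\<in>partitions n. B_coeff TYPE('a) n \<mu>)"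
    by (simp add: B_coeff_def b_coeff_def)
  finally have "real ?k * (real CARD('a) - 1) ^ n = (\<Sum>\<mu>\<in>partitions n. B_coeff TYPE('a) n \<mu>)"
    using q by (simp add: of_nat_diff algebra_simps)
  moreover have "(real CARD('a) - 1) ^ n \<noteq> 0" using q by simp
  ultimately show ?thesis by (simp add: field_simps)
qed

theorem theorem2p1:
  fixes n :: nat
  assumes "n \<ge> 1"
    and "infinite (UNIV :: 'v set)"
  shows "num_iso_classes TYPE('a::{field,finite}) TYPE('v) n =
           card (orbits (monomial_group n :: 'a mat monoid) (carrier (GL n)) (monomial_act n))
       \<and> real (num_iso_classes TYPE('a) TYPE('v) n) =
           (\<Sum>\<mu> \<in> partitions n. B_coeff TYPE('a) n \<mu>) / (real CARD('a) - 1) ^ n"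
  unfolding num_iso_classes_eq_card_orbits[OF assms(2)]
  by (rule conjI[OF refl card_orbits_eq_partition_sum])

end
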